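(* Let $\Sigma_A$ be an irreducible shift of finite type. Then for every $\omega\in\Sigma_A$, $$h^B(\mathrm{LY}_\omega(\Sigma_A,\sigma))=h(\Sigma_A),$$ that is, $$\dim_H(\mathrm{LY}_\omega(\Sigma_A,\sigma))=\dim_H(\Sigma_A).$$
   Context: $\mathbb{N}=\{0,1,2,\dots\}$. Let $\mathcal{A}=\{1,\dots,K\}$ be a finite alphabet, $\Sigma=\mathcal{A}^{\mathbb{N}}$, $\sigma$ the shift map $(\sigma x)_i=x_{i+1}$, and equip $\Sigma$ with the metric $\rho(x,y)=K^{-\min\{n\ge 0:\,x_n\neq y_n\}}$ for $x\ne y$, $\rho(x,x)=0$. For a $K\times K$ matrix $A$ with entries in $\{0,1\}$, the shift of finite type is $\Sigma_A=\{x\in\Sigma: A_{x_i,x_{i+1}}=1\text{ for all }i\in\mathbb{N}\}$ with the shift map $\sigma$. It is irreducible if for any $i,j$ there is $r>0$ with $(A^r)_{i,j}>0$. $h(\Sigma_A)$ denotes the topological entropy of $(\Sigma_A,\sigma)$. For a topological dynamical system $(X,T)$ with metric $\rho$, $(x,y)$ is a Li--Yorke pair if $\liminf_{n\to\infty}\rho(T^nx,T^ny)=0$ and $\limsup_{n\to\infty}\rho(T^nx,T^ny)>0$; $\mathrm{LY}_x(X,T)=\{y\in X:(x,y)\text{ is a Li--Yorke pair}\}$. Bowen entropy of $Z\subset\Sigma$: for a finite word $W$ over $\mathcal{A}$ let $|W|$ be its length and $[W]=\{x\in\Sigma: x_0\cdots x_{|W|-1}=W\}$ its cylinder. For $s\ge0$,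 $N\in\mathbb{N}$, $\mathcal{H}^s_N(Z)=\inf_{\mathcal{W}}\sum_{W\in\mathcal{W}}e^{-s|W|}$, the infimum being over all (countable) covers $\mathcal W$ of $Z$ by cylinders of length larger than $N$; $\mathcal{H}^s(Z)=\lim_{N\to\infty}\mathcal{H}^s_N(Z)$ and $h^B(Z)=\inf\{s\ge0:\mathcal{H}^s(Z)=0\}$. $\dim_H$ is Hausdorff dimension with respect to $\rho$ (the empty set has dimension $0$). *)

theory Defs
  imports "HOL-Analysis.Analysis"
begin

text \<open>
  The alphabet $\{1,\dots,K\}$ is a finite type \<open>'a\<close>, with $K$ = \<open>CARD('a)\<close>; the full shift
  $\Sigma$ is then the whole type \<open>nat \<Rightarrow> 'a\<close>. Metrics are passed as explicit functions, since
  $\rho$ is not the type class metric of a function type.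
\<close>

definition shift :: "(nat \<Rightarrow> 'a) \<Rightarrow> nat \<Rightarrow> 'a" where
  "shift x = (\<lambda>i. x (Suc i))"

definition rho :: "(nat \<Rightarrow> 'a::finite) \<Rightarrow> (nat \<Rightarrow> 'a) \<Rightarrow> real" where
  "rho x y = (if x = y then 0 else real CARD('a) powi (- int (LEAST n. x n \<noteq> y n)))"


text \<open>The operation \<open>^\<close> on vector types acts componentwise, so matrix powers are spelled out.\<close>

definition mat_power :: "'b::semiring_1^'n^'n \<Rightarrow> nat \<Rightarrow> 'b^'n^'n" where
  "mat_power A r = (((**) A) ^^ r) (mat 1)"

definition zero_one_matrix :: "nat^'n^'n \<Rightarrow> bool" where
  "zero_one_matrix A \<longleftrightarrow> (\<forall>i j. A $ i $ j \<in> {0, 1})"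

definition irreducible_matrix :: "nat^'n^'n \<Rightarrow> bool" where
  "irreducible_matrix A \<longleftrightarrow> (\<forall>i j. \<exists>r>0. mat_power A r $ i $ j > 0)"

definition SFT :: "nat^'a^'a \<Rightarrow> (nat \<Rightarrow> 'a) set" where
  "SFT A = {x. \<forall>i. A $ x i $ x (Suc i) = 1}"


definition li_yorke_pair :: "('x \<Rightarrow> 'x \<Rightarrow> real) \<Rightarrow> ('x \<Rightarrow> 'x) \<Rightarrow> 'x \<Rightarrow> 'x \<Rightarrow> bool" where
  "li_yorke_pair d T x y \<longleftrightarrow>
     liminf (\<lambda>n. ereal (d ((T ^^ n) x) ((T ^^ n) y))) = 0 \<and>
     limsup (\<lambda>n. ereal (d ((T ^^ n) x) ((T ^^ n) y))) > 0"

definition LY :: "('x \<Rightarrow> 'x \<Rightarrow> real) \<Rightarrow> 'x set \<Rightarrow> ('x \<Rightarrow> 'x) \<Rightarrow> 'x \<Rightarrow> 'x set" where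
  "LY d X T x = {y \<in> X. li_yorke_pair d T x y}"


text \<open>
  Topological entropy of a compact system $(X,T)$ in the Bowen--Dinaburg form,
  $\lim_{\varepsilon\to 0}\limsup_{n\to\infty}\frac1n\log s(n,\varepsilon)$, where $s(n,\varepsilon)$
  is the largest cardinality of an $(n,\varepsilon)$-separated subset of $X$. The inner supremum
  below is $\frac1n\log s(n,\varepsilon)$ because the logarithm is monotone, and the limit in
  $\varepsilon$ is a supremum because $s(n,\varepsilon)$ grows as $\varepsilon$ decreases.
\<close>

definition separated ::
  "('x \<Rightarrow> 'x \<Rightarrow> real) \<Rightarrow> ('x \<Rightarrow> 'x) \<Rightarrow> nat \<Rightarrow> real \<Rightarrow> 'x set \<Rightarrow> bool" where
  "separated d T n \<epsilon> E \<longleftrightarrow>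
     (\<forall>x\<in>E. \<forall>y\<in>E. x \<noteq> y \<longrightarrow> (\<exists>k<n. d ((T ^^ k) x) ((T ^^ k) y) > \<epsilon>))"

definition topological_entropy ::
  "('x \<Rightarrow> 'x \<Rightarrow> real) \<Rightarrow> 'x set \<Rightarrow> ('x \<Rightarrow> 'x) \<Rightarrow> ereal" where
  "topological_entropy d X T =
     (SUP \<epsilon>\<in>{0<..}. limsup (\<lambda>n.
        SUP E\<in>{E. E \<subseteq> X \<and> finite E \<and> separated d T n \<epsilon> E}. ereal (ln (real (card E)) / real n)))"


definition cylinder :: "'a list \<Rightarrow> (nat \<Rightarrow> 'a) set" where
  "cylinder W = {x. map x [0..<length W] = W}"

text \<open>Covers need no countability condition: there are only countably many words.\<close>

definition bowen_pre :: "real \<Rightarrow> nat \<Rightarrow> (nat \<Rightarrow> 'a::finite) set \<Rightarrow> ennreal" where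
  "bowen_pre s N Z =
     (INF C\<in>{C. Z \<subseteq> (\<Union>W\<in>C. cylinder W) \<and> (\<forall>W\<in>C. length W > N)}.
        (\<Sum>\<^sub>\<infinity>W\<in>C. ennreal (exp (- s * real (length W)))))"

definition bowen_measure :: "real \<Rightarrow> (nat \<Rightarrow> 'a::finite) set \<Rightarrow> ennreal" where
  "bowen_measure s Z = lim (\<lambda>N. bowen_pre s N Z)"

definition bowen_entropy :: "(nat \<Rightarrow> 'a::finite) set \<Rightarrow> ereal" where
  "bowen_entropy Z = Inf (ereal ` {s. s \<ge> 0 \<and> bowen_measure s Z = 0})"


definition set_diam :: "('x \<Rightarrow> 'x \<Rightarrow> real) \<Rightarrow> 'x set \<Rightarrow> ennreal" where
  "set_diam d U = (SUP x\<in>U. SUP y\<in>U. ennreal (d x y))"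

text \<open>
  $(\mathrm{diam}\,U)^s$ with the usual conventions: $0$ for the empty set, and $0^0=1$ for nonempty
  sets (whereas \<open>0 powr 0 = 0\<close>). It is only used for sets of finite diameter.
\<close>

definition diam_powr :: "('x \<Rightarrow> 'x \<Rightarrow> real) \<Rightarrow> real \<Rightarrow> 'x set \<Rightarrow> ennreal" where
  "diam_powr d s U =
     (if U = {} then 0 else if s = 0 then 1 else ennreal (enn2real (set_diam d U) powr s))"

definition hausdorff_pre ::
  "('x \<Rightarrow> 'x \<Rightarrow> real) \<Rightarrow> real \<Rightarrow> real \<Rightarrow> 'x set \<Rightarrow> ennreal" where
  "hausdorff_pre d s \<delta> Z =
     (INF U\<in>{U :: nat \<Rightarrow> 'x set. Z \<subseteq> (\<Union>n. U n) \<and> (\<forall>n. set_diam d (U n) \<le> ennreal \<delta>)}.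
        (\<Sum>n. diam_powr d s (U n)))"

definition hausdorff_measure :: "('x \<Rightarrow> 'x \<Rightarrow> real) \<Rightarrow> real \<Rightarrow> 'x set \<Rightarrow> ennreal" where
  "hausdorff_measure d s Z = (SUP \<delta>\<in>{0<..}. hausdorff_pre d s \<delta> Z)"

definition hausdorff_dim :: "('x \<Rightarrow> 'x \<Rightarrow> real) \<Rightarrow> 'x set \<Rightarrow> ereal" where
  "hausdorff_dim d Z = Inf (ereal ` {s. s \<ge> 0 \<and> hausdorff_measure d s Z = 0})"

end

theory Submission imports Defs begin

text \<open>
  Fix a state \<open>b\<close> that \<open>\<omega>\<close> visits infinitely often. If \<open>s\<close> is below the topological entropy, there is
  a length \<open>L\<close> with more than $e^{sL}$ loops at \<open>b\<close> of length \<open>L\<close>, such that \<open>\<omega>\<close> is at \<open>b\<close> at infinitely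
  many times of one class \<open>t\<close> modulo \<open>L\<close>, and such that every state visited by \<open>\<omega>\<close> at a time of this
  class is connected to \<open>b\<close> by a path of length exactly \<open>L\<close>. A point that concatenates arbitrary loops
  at \<open>b\<close> can therefore switch to the orbit of \<open>\<omega>\<close> at such a visit, follow it for any number of blocks,
  and return to \<open>b\<close> within one further block. Copying longer and longer stretches of \<open>\<omega>\<close> along a set
  of blocks of small density, and using loops that differ from the corresponding block of \<open>\<omega>\<close>
  elsewhere, only produces Li--Yorke partners of \<open>\<omega>\<close>, and still leaves enough freedom that every
  cover of these points by cylinders has weight bounded below at exponent \<open>s\<close>. The opposite inequality
  only needs the cover of the subshift by its words of length \<open>n\<close>, and the Hausdorff dimension is the
  Bowen entropy divided by \<open>ln K\<close>.
\<close>

section \<open>Paths and powers of the transition matrix\<close>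

text \<open>A path with \<open>n\<close> edges is stored as its first \<open>n\<close> states,
  without the end \<open>j\<close>. Concatenation of paths is then plain append, and consecutive
  blocks of a sequence do not overlap. Taking \<open>hd\<close> of \<open>w @ [j]\<close> makes the
  empty path run from \<open>j\<close> to \<open>j\<close>.\<close>

definition paths :: "nat^'a^'a \<Rightarrow> nat \<Rightarrow> 'a::finite \<Rightarrow> 'a \<Rightarrow> 'a list set" where
  "paths A n i j =
     {w. length w = n \<and> hd (w @ [j]) = i \<and> successively (\<lambda>a b. A $ a $ b = 1) (w @ [j])}"

lemma finite_paths [simp]: "finite (paths A n i j)"
proof (rule finite_subset)
  show "paths A n i j \<subseteq> {w. set w \<subseteq> UNIV \<and> length w = n}" by (auto simp: paths_def)
qed (rule finite_lists_length_eq, simp)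

lemma paths_0: "paths A 0 i j = (if i = j then {[]} else {})"
  by (auto simp: paths_def)

lemma paths_Suc:
  "paths A (Suc n) i j = (\<Union>c\<in>{c. A $ i $ c = 1}. (#) i ` paths A n c j)"
proof (intro set_eqI iffI)
  fix w assume "w \<in> paths A (Suc n) i j"
  then obtain v where "w = i # v" "length v = n"
    "A $ i $ hd (v @ [j]) = 1" "successively (\<lambda>a b. A $ a $ b = 1) (v @ [j])"
    by (auto simp: paths_def length_Suc_conv successively_Cons)
  then show "w \<in> (\<Union>c\<in>{c. A $ i $ c = 1}. (#) i ` paths A n c j)"
    by (auto simp: paths_def)
next
  fix w assume "w \<in> (\<Union>c\<in>{c. A $ i $ c = 1}. (#) i ` paths A n c j)"
  then show "w \<in> paths A (Suc n) i j"
    by (auto simp: paths_def successively_Cons)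
qed

text \<open>Splitting off the first edge is the row-by-column product of \<open>A\<close> with its
  power. Lists starting from different second states are distinct because
  \<open>hd (w @ [j])\<close> recovers that state.\<close>

lemma card_paths:
  assumes "zero_one_matrix A"
  shows "card (paths A n i j) = mat_power A n $ i $ j"
proof (induction n arbitrary: i)
  case 0
  show ?case by (simp add: paths_0 mat_power_def mat_def)
next
  case (Suc n)
  have disj: "paths A n c j \<inter> paths A n c' j = {}" if "c \<noteq> c'" for c c'
    using that by (auto simp: paths_def)
  have "card (paths A (Suc n) i j) = (\<Sum>c\<in>{c. A $ i $ c = 1}. card ((#) i ` paths A n c j))"
    unfolding paths_Suc by (rule card_UN_disjoint) (use disj in auto)
  also have "\<dots> = (\<Sum>c\<in>{c. A $ i $ c = 1}. mat_power A n $ c $ j)"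
    by (simp add: card_image Suc)
  also have "\<dots> = (\<Sum>c\<in>UNIV. A $ i $ c * mat_power A n $ c $ j)"
  proof (rule sum.mono_neutral_cong_left)
    show "\<forall>c\<in>UNIV - {c. A $ i $ c = 1}. A $ i $ c * mat_power A n $ c $ j = 0"
      using assms unfolding zero_one_matrix_def by (simp add: Ball_def) (metis One_nat_def)
  qed auto
  also have "\<dots> = mat_power A (Suc n) $ i $ j"
    by (simp add: mat_power_def matrix_matrix_mult_def)
  finally show ?case .
qed

lemma mat_power_add:
  fixes A :: "nat^'n::finite^'n"
  shows "mat_power A (m + n) = mat_power A m ** mat_power A n"
  by (induction m) (simp_all add: mat_power_def matrix_mul_assoc[symmetric] matrix_mul_lid del: One_nat_def)

lemma mat_power_add_ge:
  fixes A :: "nat^'n::finite^'n"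
  shows "mat_power A m $ i $ c * mat_power A n $ c $ j \<le> mat_power A (m + n) $ i $ j"
  unfolding mat_power_add matrix_matrix_mult_def
  by simp (rule member_le_sum[where f = "\<lambda>c. mat_power A m $ i $ c * mat_power A n $ c $ j"], auto)

lemma mat_power_mult_ge:
  fixes A :: "nat^'n::finite^'n"
  shows "(mat_power A m $ i $ i) ^ k \<le> mat_power A (k * m) $ i $ i"
proof (induction k)
  case 0
  show ?case by (simp add: mat_power_def mat_def)
next
  case (Suc k)
  have "(mat_power A m $ i $ i) ^ Suc k \<le> mat_power A m $ i $ i * mat_power A (k * m) $ i $ i"
    using Suc by simp
  also have "\<dots> \<le> mat_power A (Suc k * m) $ i $ i"
    using mat_power_add_ge[of A m i i "k * m" i] by simp
  finally show ?case .
qed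

section \<open>Blocks of a sequence and splicing of blocks\<close>

definition block :: "(nat \<Rightarrow> 'a) \<Rightarrow> nat \<Rightarrow> nat \<Rightarrow> 'a list" where
  "block x k n = map x [k..<k + n]"

lemma block_in_paths:
  assumes "x \<in> SFT A"
  shows "block x k n \<in> paths A n (x k) (x (k + n))"
proof -
  have *: "block x k n @ [x (k + n)] = map x [k..<Suc (k + n)]"
    by (simp add: block_def)
  have "hd (map x [k..<Suc (k + n)]) = x k"
    by (subst hd_map) (auto simp: upt_conv_Cons simp del: upt_Suc)
  moreover have "successively (\<lambda>a b. A $ a $ b = 1) (map x [k..<Suc (k + n)])"
    using assms by (auto simp: successively_conv_nth SFT_def simp del: upt_Suc)
  ultimately show ?thesis
    unfolding paths_def mem_Collect_eq * by (simp add: block_def del: upt_Suc map_append)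
qed

lemma paths_nth:
  assumes "w \<in> paths A n i j" "l < n"
  shows "A $ (w ! l) $ ((w @ [j]) ! Suc l) = 1"
  using assms by (auto simp: paths_def successively_conv_nth nth_append)

lemma paths_hd:
  assumes "w \<in> paths A n i j"
  shows "(w @ [j]) ! 0 = i"
  using assms by (auto simp: paths_def hd_conv_nth)

text \<open>The prefix of \<open>w\<close> of length \<open>t\<close>, followed by the blocks
  \<open>x 0\<close>, \<open>x 1\<close>, ..., each meant to have length \<open>L\<close>.\<close>

definition splice_blocks :: "(nat \<Rightarrow> 'a) \<Rightarrow> nat \<Rightarrow> nat \<Rightarrow> (nat \<Rightarrow> 'a list) \<Rightarrow> nat \<Rightarrow> 'a" where
  "splice_blocks w t L x n = (if n < t then w n else x ((n - t) div L) ! ((n - t) mod L))"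

lemma splice_blocks_nth:
  "l < L \<Longrightarrow> splice_blocks w t L x (t + k * L + l) = x k ! l"
  by (simp add: splice_blocks_def)

lemma block_splice_blocks:
  assumes "length (x k) = L"
  shows "block (splice_blocks w t L x) (t + k * L) L = x k"
  using assms by (auto simp: block_def list_eq_iff_nth_eq splice_blocks_nth)

text \<open>Here \<open>e k\<close> is the state at which block \<open>k\<close> starts. As a path
  omits its end state, the letter after block \<open>k\<close> is the first letter of block
  \<open>Suc k\<close>, namely \<open>e (Suc k)\<close>; and \<open>e 0 = w t\<close> joins the
  prefix to the first block.\<close>

lemma splice_blocks_in_SFT:
  assumes "w \<in> SFT A" "L > 0" "e 0 = w t"
    and x: "\<And>k. x k \<in> paths A L (e k) (e (Suc k))"
  shows "splice_blocks w t L x \<in> SFT A"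
proof -
  let ?y = "splice_blocks w t L x"
  have start: "x k ! 0 = e k" for k
    using paths_hd[OF x[of k]] x[of k] \<open>L > 0\<close>
    by (auto simp: nth_append paths_def split: if_splits)
  have "A $ ?y n $ ?y (Suc n) = 1" for n
  proof (cases "n < t")
    case True
    then have "?y n = w n" "?y (Suc n) = w (Suc n)"
      using start[of 0] assms(2,3) by (cases "Suc n = t"; simp add: splice_blocks_def)+
    then show ?thesis using assms(1) by (simp add: SFT_def)
  next
    case False
    define k l where "k = (n - t) div L" and "l = (n - t) mod L"
    have l: "l < L" and n: "n = t + k * L + l"
      using False \<open>L > 0\<close> by (auto simp: k_def l_def)
    have "?y n = x k ! l" using l n by (simp add: splice_blocks_nth)
    moreover have "?y (Suc n) = (x k @ [e (Suc k)]) ! Suc l"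
    proof (cases "Suc l < L")
      case True
      then show ?thesis
        using splice_blocks_nth[of "Suc l" L w t x k] n x[of k] by (simp add: nth_append paths_def)
    next
      case False
      then have "Suc n = t + Suc k * L + 0" using n l by simp
      then have "?y (Suc n) = x (Suc k) ! 0"
        using splice_blocks_nth[of 0 L w t x "Suc k"] \<open>L > 0\<close> by simp
      then show ?thesis using False l x[of k] start by (simp add: nth_append paths_def)
    qed
    ultimately show ?thesis using paths_nth[OF x l] by simp
  qed
  then show ?thesis by (simp add: SFT_def)
qed

section \<open>Covers by cylinders and sparse sets\<close>

lemma sum_infsum_ennreal_le:
  fixes f :: "'i \<Rightarrow> ennreal"
  assumes "finite A" "\<And>a. a \<in> A \<Longrightarrow> B a \<subseteq> I"
    and "\<And>a a'. a \<in> A \<Longrightarrow> a' \<in> A \<Longrightarrow> a \<noteq> a' \<Longrightarrow> B a \<inter> B a' = {}"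
  shows "(\<Sum>a\<in>A. infsum f (B a)) \<le> infsum f I"
proof -
  have "(\<Sum>a\<in>A. infsum f (B a)) = infsum f (\<Union>a\<in>A. B a)"
    using assms(1,3)
  proof (induction A rule: finite_induct)
    case (insert a A)
    have "infsum f (B a \<union> (\<Union>a\<in>A. B a)) = infsum f (B a) + infsum f (\<Union>a\<in>A. B a)"
    proof (rule infsum_Un_disjoint)
      show "B a \<inter> (\<Union>a\<in>A. B a) = {}" using insert by fastforce
    qed (auto intro: nonneg_summable_on_complete)
    then show ?case using insert by simp
  qed simp
  also have "\<dots> \<le> infsum f I"
    by (rule infsum_mono_neutral) (use assms(2) in \<open>auto intro: nonneg_summable_on_complete\<close>)
  finally show ?thesis .
qed

lemma infsum_ge_term_ennreal:
  fixes f :: "'i \<Rightarrow> ennreal"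
  assumes "i \<in> I"
  shows "f i \<le> infsum f I"
proof -
  have "infsum f {i} \<le> infsum f I"
    by (rule infsum_mono_neutral) (use assms in \<open>auto intro: nonneg_summable_on_complete\<close>)
  then show ?thesis by simp
qed

text \<open>
  This replaces the mass distribution principle for the uniform product measure on \<open>\<Prod>k. A k\<close>.
  If the total weight of the cover were below \<open>1\<close>, one could descend along prefixes \<open>p\<close> whose
  extensions in the cover weigh less than the cylinder of \<open>p\<close>, and reach an uncovered point.
\<close>

lemma cylinder_cover_weight_ge:
  fixes A :: "nat \<Rightarrow> 'b set" and v :: "'i \<Rightarrow> 'b list"
  assumes fin: "\<And>k. finite (A k)" and ne: "\<And>k. A k \<noteq> {}"
    and cover: "\<And>x. (\<And>k. x k \<in> A k) \<Longrightarrow> \<exists>i\<in>I. map x [0..<length (v i)] = v i"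
  shows "1 \<le> (\<Sum>\<^sub>\<infinity>i\<in>I. ennreal (\<Prod>k<length (v i). 1 / real (card (A k))))"
proof (rule ccontr)
  define m where "m n = (\<Prod>k<n. 1 / real (card (A k)))" for n
  \<comment> \<open>\<open>J p\<close> collects the cover words that extend the prefix
    \<open>p\<close>, \<open>S p\<close> is their weight, and \<open>m n\<close> is the mass of one
    prefix of length \<open>n\<close>.\<close>
  define J where "J p = {i\<in>I. length p \<le> length (v i) \<and> take (length p) (v i) = p}" for p
  define S where "S p = (\<Sum>\<^sub>\<infinity>i\<in>J p. ennreal (m (length (v i))))" for p
  assume "\<not> ?thesis"
  then have S0: "S [] < ennreal (m (length ([]::'b list)))"
    by (simp add: S_def J_def m_def)
  \<comment> \<open>If every child of \<open>p\<close> carried at least its own mass, summing over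
    the disjoint families \<open>J (p @ [a])\<close> would give \<open>S p\<close> at least the mass
    of \<open>p\<close>.\<close>
  have step: "\<exists>a\<in>A (length p). S (p @ [a]) < ennreal (m (Suc (length p)))"
    if "S p < ennreal (m (length p))" for p
  proof (rule ccontr)
    let ?A = "A (length p)"
    assume "\<not> ?thesis"
    then have *: "ennreal (m (Suc (length p))) \<le> S (p @ [a])" if "a \<in> ?A" for a
      using that by (auto simp: not_less)
    have mpos: "0 \<le> m n" for n by (simp add: m_def prod_nonneg)
    have "real (card ?A) \<noteq> 0" using fin ne by simp
    then have "m (length p) = (\<Sum>a\<in>?A. m (Suc (length p)))"
      by (simp add: m_def)
    then have "ennreal (m (length p)) = (\<Sum>a\<in>?A. ennreal (m (Suc (length p))))"
      using mpos by (simp add: sum_ennreal del: sum_constant)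
    also have "\<dots> \<le> (\<Sum>a\<in>?A. S (p @ [a]))"
      by (rule sum_mono) (rule *)
    also have "\<dots> \<le> S p"
      unfolding S_def
    proof (rule sum_infsum_ennreal_le)
      show "J (p @ [a]) \<subseteq> J p" for a
      proof
        fix i assume "i \<in> J (p @ [a])"
        then have "i \<in> I" "Suc (length p) \<le> length (v i)" "take (Suc (length p)) (v i) = p @ [a]"
          by (auto simp: J_def)
        moreover have "take (length p) (v i) = take (length p) (take (Suc (length p)) (v i))"
          by (simp only: take_take) simp
        ultimately show "i \<in> J p" by (simp add: J_def)
      qed
      show "J (p @ [a]) \<inter> J (p @ [a']) = {}" if "a \<noteq> a'" for a a'
        using that by (auto simp: J_def)
    qed (rule fin)
    finally show False using that by simp
  qed
  define a where "a p = (SOME a. a \<in> A (length p) \<and> S (p @ [a]) < ennreal (m (Suc (length p))))" for p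
  have a: "a p \<in> A (length p) \<and> S (p @ [a p]) < ennreal (m (Suc (length p)))"
    if "S p < ennreal (m (length p))" for p
    unfolding a_def by (rule someI_ex) (use step[OF that] in blast)
  define q where "q = rec_nat [] (\<lambda>_ p. p @ [a p])"
  have q0: "q 0 = []" and qS: "q (Suc n) = q n @ [a (q n)]" for n
    by (simp_all add: q_def)
  have len: "length (q n) = n" for n by (induction n) (simp_all add: q0 qS)
  have inv: "S (q n) < ennreal (m n)" for n
  proof (induction n)
    case 0
    then show ?case using S0 by (simp add: q0)
  next
    case (Suc n)
    then show ?case using a[of "q n"] by (simp add: len qS)
  qed
  define x where "x n = a (q n)" for n
  have map_x: "map x [0..<n] = q n" for n
    by (induction n) (simp_all add: q0 qS x_def)
  have "x k \<in> A k" for k using a[of "q k"] inv[of k] by (simp add: x_def len)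
  then obtain i where i: "i \<in> I" "map x [0..<length (v i)] = v i" using cover by blast
  \<comment> \<open>The word \<open>v i\<close> lies on the light branch, yet its own term already
    gives \<open>S (v i)\<close> the full mass of that prefix.\<close>
  then have "i \<in> J (v i)" by (simp add: J_def)
  then have "ennreal (m (length (v i))) \<le> S (v i)"
    unfolding S_def by (rule infsum_ge_term_ennreal)
  moreover have "v i = q (length (v i))" using i(2) map_x by simp
  ultimately show False using inv[of "length (v i)"] by simp
qed

text \<open>\<open>F\<close> is a union of intervals \<open>{s i..s i + i}\<close> with
  \<open>s i\<close> in \<open>S\<close> and at least \<open>q * (i + 1)\<^sup>2\<close>, so
  \<open>F\<close> can be entered only at some \<open>s i\<close>. With \<open>M\<close> the largest
  index such that \<open>s M < n\<close>, only intervals of index at most \<open>M\<close> meet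
  \<open>{..<n}\<close>. Together they have at most \<open>(M + 1)\<^sup>2\<close> points, and
  \<open>q\<close> times this is at most \<open>s M\<close>.\<close>

lemma ex_sparse_set:
  fixes S :: "nat set"
  assumes "infinite S" "q > 0"
  shows "\<exists>F s. (\<forall>n. s n \<ge> n) \<and> (\<forall>n. {s n..s n + n} \<subseteq> F) \<and>
    (\<forall>k. k \<notin> F \<longrightarrow> Suc k \<in> F \<longrightarrow> Suc k \<in> S) \<and> (\<forall>n. q * card (F \<inter> {..<n}) \<le> n)"
proof -
  have "\<exists>k\<in>S. q * (i + 1)\<^sup>2 \<le> k" for i
    using assms(1) by (metis infinite_nat_iff_unbounded_le)
  then obtain s where s: "\<And>i. s i \<in> S" "\<And>i. q * (i + 1)\<^sup>2 \<le> s i" by metis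
  define F where "F = (\<Union>i. {s i..s i + i})"
  have ge: "s i \<ge> i" for i
  proof -
    have "i \<le> 1 * (i + 1)\<^sup>2" by (simp add: power2_eq_square)
    also have "\<dots> \<le> q * (i + 1)\<^sup>2" using assms(2) by (intro mult_right_mono) auto
    finally show ?thesis using s(2)[of i] by simp
  qed
  have count: "q * card (F \<inter> {..<n}) \<le> n" for n
  proof -
    define T where "T = {i. s i < n}"
    have T: "finite T" by (rule finite_subset[of _ "{..<n}"]) (use ge in \<open>auto simp: T_def intro: le_less_trans\<close>)
    show ?thesis
    proof (cases "T = {}")
      case True
      then have "F \<inter> {..<n} = {}" by (auto simp: T_def F_def) (meson le_less_trans)
      then show ?thesis by simp
    next
      case False
      define M where "M = Max T"
      have M: "M \<in> T" "\<And>i. i \<in> T \<Longrightarrow> i \<le> M" using T False by (auto simp: M_def)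
      have "card (F \<inter> {..<n}) \<le> card (\<Union>i\<in>{..M}. {s i..s i + i})"
      proof (rule card_mono)
        show "F \<inter> {..<n} \<subseteq> (\<Union>i\<in>{..M}. {s i..s i + i})"
        proof
          fix k assume "k \<in> F \<inter> {..<n}"
          then obtain i where i: "s i \<le> k" "k \<le> s i + i" "k < n" by (auto simp: F_def)
          then have "i \<le> M" by (intro M) (simp add: T_def)
          then show "k \<in> (\<Union>i\<in>{..M}. {s i..s i + i})" using i by auto
        qed
      qed simp
      also have "\<dots> \<le> (\<Sum>i\<in>{..M}. card {s i..s i + i})" by (rule card_UN_le) simp
      also have "\<dots> \<le> (\<Sum>i\<in>{..M}. M + 1)" by (rule sum_mono) simp
      also have "\<dots> = (M + 1)\<^sup>2" by (simp add: power2_eq_square)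
      finally have "q * card (F \<inter> {..<n}) \<le> q * (M + 1)\<^sup>2" by (rule mult_left_mono) simp
      also have "\<dots> \<le> s M" by (rule s)
      also have "\<dots> \<le> n" using M(1) by (simp add: T_def)
      finally show ?thesis .
    qed
  qed
  have enter: "Suc k \<in> S" if "k \<notin> F" "Suc k \<in> F" for k
  proof -
    obtain i where i: "s i \<le> Suc k" "Suc k \<le> s i + i" using \<open>Suc k \<in> F\<close> by (auto simp: F_def)
    moreover have "\<not> s i \<le> k" using \<open>k \<notin> F\<close> i(2) unfolding F_def by fastforce
    ultimately have "Suc k = s i" by simp
    then show ?thesis using s(1) by simp
  qed
  show ?thesis
    by (rule exI[of _ F], rule exI[of _ s]) (use ge count enter in \<open>auto simp: F_def\<close>)
qed

section \<open>Li--Yorke pairs, separated sets and loops\<close>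

lemma shift_funpow: "(shift ^^ n) x = (\<lambda>i. x (n + i))"
  by (induction n) (auto simp: shift_def fun_eq_iff)

lemma rho_nonneg [simp]: "rho x y \<ge> 0"
  by (simp add: rho_def)

lemma card_UNIV_ge_2:
  assumes "(a::'a::finite) \<noteq> b"
  shows "CARD('a) \<ge> 2"
  using card_mono[of UNIV "{a, b}"] assms by simp

lemma rho_first_difference:
  fixes x y :: "nat \<Rightarrow> 'a::finite"
  assumes "x m \<noteq> y m" "\<And>i. i < m \<Longrightarrow> x i = y i"
  shows "rho x y = (1 / real CARD('a)) ^ m"
proof -
  have "(LEAST n. x n \<noteq> y n) = m"
    using assms by (intro Least_equality) (auto intro: leI)
  moreover have "x \<noteq> y" using assms(1) by auto
  ultimately show ?thesis by (simp add: rho_def power_int_minus power_one_over inverse_eq_divide)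
qed

lemma ex_first_difference:
  assumes "x \<noteq> y"
  obtains m where "x m \<noteq> y m" "\<And>i. i < m \<Longrightarrow> x i = y (i :: nat)"
proof (rule that[of "LEAST n. x n \<noteq> y n"])
  show "x (LEAST n. x n \<noteq> y n) \<noteq> y (LEAST n. x n \<noteq> y n)"
    by (rule LeastI_ex) (use assms in auto)
qed (use not_less_Least in blast)

text \<open>The base 1/2 gives a bound tending to 0 also for a one-letter alphabet, where the powers
  of \<open>1 / CARD('a)\<close> stay 1 but \<open>rho\<close> vanishes.\<close>

lemma rho_le:
  fixes x y :: "nat \<Rightarrow> 'a::finite"
  assumes "\<And>i. i < m \<Longrightarrow> x i = y i"
  shows "rho x y \<le> (1 / 2) ^ m"
proof (cases "x = y")
  case False
  then obtain n where n: "x n \<noteq> y n" "\<And>i. i < n \<Longrightarrow> x i = y i"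
    by (rule ex_first_difference) blast
  then have "m \<le> n" using assms not_less by blast
  have K: "real CARD('a) \<ge> 2" using card_UNIV_ge_2[OF n(1)] by simp
  have "rho x y = (1 / real CARD('a)) ^ n"
    using n by (rule rho_first_difference)
  also have "\<dots> \<le> (1 / 2) ^ n"
    using K by (intro power_mono) (auto simp: field_simps)
  also have "\<dots> \<le> (1 / 2) ^ m"
    using \<open>m \<le> n\<close> by (intro power_decreasing) auto
  finally show ?thesis .
qed (simp add: rho_def)

lemma rho_eq_1: "x 0 \<noteq> y 0 \<Longrightarrow> rho x y = 1"
  using rho_first_difference[of x 0 y] by simp

text \<open>Long agreements at late times make the distance arbitrarily small, and each late
  mismatch makes it exactly 1 at that time.\<close>

lemma li_yorke_pair_rhoI:
  assumes "\<And>m. \<exists>n\<ge>m. \<forall>i<m. x (n + i) = y (n + i)"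
    and "\<And>m. \<exists>n\<ge>m. x n \<noteq> y n"
  shows "li_yorke_pair rho shift x y"
proof -
  define d where "d n = ereal (rho ((shift ^^ n) x) ((shift ^^ n) y))" for n
  have "liminf d \<le> 0"
  proof (rule ccontr)
    assume "\<not> ?thesis"
    then obtain e where e: "0 < ereal e" "ereal e < liminf d"
      using ereal_dense2[of 0 "liminf d"] by (auto simp: not_le simp flip: zero_ereal_def)
    then obtain N where N: "\<And>n. n \<ge> N \<Longrightarrow> ereal e < d n"
      using less_LiminfD[of "ereal e" sequentially d] by (auto simp: eventually_sequentially)
    obtain m0 where m0: "(1 / 2 :: real) ^ m0 < e"
      using real_arch_pow_inv[of e "1 / 2"] e(1) by auto
    obtain n where n: "n \<ge> max N m0" "\<forall>i<max N m0. x (n + i) = y (n + i)"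
      using assms(1) by blast
    have "rho ((shift ^^ n) x) ((shift ^^ n) y) \<le> (1 / 2) ^ m0"
      using n by (intro rho_le) (auto simp: shift_funpow)
    then show False using N[of n] n(1) m0 by (simp add: d_def)
  qed
  moreover have "0 \<le> liminf d"
    by (rule Liminf_bounded) (simp add: d_def)
  moreover have "1 \<le> limsup d"
  proof (rule ccontr)
    assume "\<not> ?thesis"
    then obtain N where N: "\<And>n. n \<ge> N \<Longrightarrow> d n < 1"
      using Limsup_lessD[of sequentially d 1] by (auto simp: eventually_sequentially not_le)
    obtain n where n: "n \<ge> N" "x n \<noteq> y n" using assms(2) by blast
    then have "rho ((shift ^^ n) x) ((shift ^^ n) y) = 1"
      by (intro rho_eq_1) (simp add: shift_funpow)
    then show False using N[OF n(1)] by (simp add: d_def one_ereal_def)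
  qed
  ultimately show ?thesis
    unfolding li_yorke_pair_def d_def[symmetric]
    by (auto intro: antisym less_le_trans[of 0 1])
qed

section \<open>Growth of the number of words and of loops\<close>

definition words_number :: "nat^'a^'a \<Rightarrow> nat \<Rightarrow> nat" where
  "words_number A n = (\<Sum>i\<in>UNIV. \<Sum>j\<in>UNIV. mat_power A n $ i $ j)"

text \<open>Only infinitely many \<open>n\<close> are required, because the entropy is defined
  through a limsup in \<open>n\<close>.\<close>

definition growth_above :: "nat^'a::finite^'a \<Rightarrow> real \<Rightarrow> bool" where
  "growth_above A s \<longleftrightarrow> (\<forall>n0. \<exists>n\<ge>n0. exp (s * real n) \<le> real (words_number A n))"

lemma card_blocks_le:
  assumes "zero_one_matrix A" "E \<subseteq> SFT A"
  shows "finite ((\<lambda>x. block x 0 n) ` E)" "card ((\<lambda>x. block x 0 n) ` E) \<le> words_number A n"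
proof -
  have sub: "(\<lambda>x. block x 0 n) ` E \<subseteq> (\<Union>i\<in>UNIV. \<Union>j\<in>UNIV. paths A n i j)"
  proof
    fix w assume "w \<in> (\<lambda>x. block x 0 n) ` E"
    then obtain x where "x \<in> SFT A" "w = block x 0 n" using assms(2) by auto
    then have "w \<in> paths A n (x 0) (x (0 + n))" by (simp only: block_in_paths)
    then show "w \<in> (\<Union>i\<in>UNIV. \<Union>j\<in>UNIV. paths A n i j)" by blast
  qed
  then show "finite ((\<lambda>x. block x 0 n) ` E)" by (rule finite_subset) simp
  have "card ((\<lambda>x. block x 0 n) ` E) \<le> card (\<Union>i\<in>UNIV. \<Union>j\<in>UNIV. paths A n i j)"
    by (rule card_mono[OF _ sub]) simp
  also have "\<dots> \<le> (\<Sum>i\<in>UNIV. card (\<Union>j\<in>UNIV. paths A n i j))"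
    by (rule card_UN_le) simp
  also have "\<dots> \<le> (\<Sum>i\<in>UNIV. \<Sum>j\<in>UNIV. card (paths A n i j))"
    by (intro sum_mono card_UN_le) simp
  finally show "card ((\<lambda>x. block x 0 n) ` E) \<le> words_number A n"
    by (simp add: words_number_def card_paths[OF assms(1)])
qed

text \<open>Points that are \<open>(n, \<epsilon>)\<close>-separated differ within their first
  \<open>n + m\<close> letters once \<open>(1 / 2) ^ m < \<epsilon>\<close>. The \<open>m\<close>
  extra letters are paid for by the gap between \<open>s1\<close> and \<open>s\<close>.\<close>

lemma growth_above_if_less_topological_entropy:
  assumes "zero_one_matrix A" "ereal s < topological_entropy rho (SFT A) shift" "0 \<le> s1" "s1 < s"
  shows "growth_above A s1"
  unfolding growth_above_def
proof
  fix n0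
  obtain \<epsilon> where "\<epsilon> > 0" and \<epsilon>: "ereal s < limsup (\<lambda>n.
        SUP E\<in>{E. E \<subseteq> SFT A \<and> finite E \<and> separated rho shift n \<epsilon> E}. ereal (ln (real (card E)) / real n))"
    (is "_ < limsup ?f")
    using assms(2) unfolding topological_entropy_def less_SUP_iff by auto
  obtain m where m: "(1 / 2 :: real) ^ m < \<epsilon>"
    using real_arch_pow_inv[of \<epsilon> "1 / 2"] \<open>\<epsilon> > 0\<close> by auto
  \<comment> \<open>This threshold yields \<open>s1 * (n + m) \<le> s * n\<close> for all
    \<open>n \<ge> n1\<close>.\<close>
  obtain n1 where n1: "s1 * real m / (s - s1) \<le> real n1" using real_arch_simple by blast
  have "\<exists>n\<ge>max 1 (max n0 n1). ereal s < ?f n"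
  proof (rule ccontr)
    assume "\<not> ?thesis"
    then have "\<forall>\<^sub>F n in sequentially. ?f n \<le> ereal s"
      unfolding eventually_sequentially by (meson not_less)
    then have "limsup ?f \<le> ereal s" by (rule Limsup_bounded)
    then show False using \<epsilon> by simp
  qed
  then obtain n where n: "n \<ge> 1" "n \<ge> n0" "n \<ge> n1" and "ereal s < ?f n" by auto
  then obtain E where E: "E \<subseteq> SFT A" "finite E" "separated rho shift n \<epsilon> E"
    "s < ln (real (card E)) / real n"
    unfolding less_SUP_iff by auto
  have "inj_on (\<lambda>x. block x 0 (n + m)) E"
  proof (rule inj_onI, rule ccontr)
    fix x y assume xy: "x \<in> E" "y \<in> E" "block x 0 (n + m) = block y 0 (n + m)" "x \<noteq> y"
    then obtain k where k: "k < n" "\<epsilon> < rho ((shift ^^ k) x) ((shift ^^ k) y)"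
      using E(3) by (auto simp: separated_def)
    have "x i = y i" if "i < n + m" for i
      using xy(3) that by (auto simp: block_def)
    then have "rho ((shift ^^ k) x) ((shift ^^ k) y) \<le> (1 / 2) ^ m"
      using k(1) by (intro rho_le) (simp add: shift_funpow)
    then show False using k(2) m by simp
  qed
  then have "card E = card ((\<lambda>x. block x 0 (n + m)) ` E)" by (simp add: card_image)
  also have "\<dots> \<le> words_number A (n + m)" using assms(1) E(1) by (rule card_blocks_le)
  finally have le: "real (card E) \<le> real (words_number A (n + m))" by simp
  have ln: "s * real n < ln (real (card E))" using E(4) n(1) by (simp add: field_simps)
  moreover have "0 < s * real n" using assms(3,4) n(1) by simp
  \<comment> \<open>An empty \<open>E\<close> is excluded since \<open>ln 0 = 0\<close> is not
    positive.\<close>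
  ultimately have "card E > 0" by (cases "card E = 0") auto
  have "s1 * real m \<le> (s - s1) * real n1"
    using n1 assms(4) by (simp add: field_simps)
  also have "\<dots> \<le> (s - s1) * real n" using n(3) assms(4) by (intro mult_left_mono) auto
  finally have "s1 * real (n + m) \<le> s * real n" by (simp add: algebra_simps)
  then have "exp (s1 * real (n + m)) \<le> exp (ln (real (card E)))" using ln by simp
  also have "\<dots> = real (card E)" using \<open>card E > 0\<close> by simp
  finally have "exp (s1 * real (n + m)) \<le> real (words_number A (n + m))" using le by simp
  then show "\<exists>n\<ge>n0. exp (s1 * real n) \<le> real (words_number A n)"
    using n(2) by (intro exI[of _ "n + m"]) auto
qed

text \<open>Some pair \<open>i\<close>, \<open>j\<close> is joined by at least the average number of
  paths of length \<open>n\<close>. Prepending a fixed path from \<open>b\<close> to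
  \<open>i\<close> and appending one from \<open>j\<close> to \<open>b\<close> turns these into
  loops at \<open>b\<close>. The connections have bounded length, so this costs a factor that
  \<open>s2 - s1\<close> absorbs for large \<open>n\<close>.\<close>

lemma ex_many_loops:
  fixes A :: "nat^'a::finite^'a"
  assumes "irreducible_matrix A" "growth_above A s2" "0 \<le> s1" "s1 < s2"
  shows "\<exists>L\<ge>N. exp (s1 * real L) \<le> real (mat_power A L $ b $ b)"
proof -
  define r where "r i j = (SOME r. mat_power A r $ i $ j > 0)" for i j
  have r: "mat_power A (r i j) $ i $ j > 0" for i j
    unfolding r_def by (rule someI_ex) (use assms(1) in \<open>unfold irreducible_matrix_def, blast\<close>)
  define R where "R = (\<Sum>i\<in>UNIV. \<Sum>j\<in>UNIV. r i j)"
  have R: "r i j \<le> R" for i j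
  proof -
    have "r i j \<le> (\<Sum>j\<in>UNIV. r i j)" by (rule member_le_sum) auto
    also have "\<dots> \<le> R" unfolding R_def
      by (rule member_le_sum[where f = "\<lambda>i. \<Sum>j\<in>UNIV. r i j"]) auto
    finally show ?thesis .
  qed
  define K where "K = real CARD('a)"
  have K: "K > 0" by (simp add: K_def)
  \<comment> \<open>\<open>ln (K * K)\<close> pays for the choice of the pair of ends,
    \<open>2 * R * s1\<close> for the two connecting paths.\<close>
  obtain n0 where n0: "(ln (K * K) + 2 * real R * s1) / (s2 - s1) \<le> real n0"
    using real_arch_simple by blast
  obtain n where n: "n \<ge> max N n0" "exp (s2 * real n) \<le> real (words_number A n)"
    using assms(2) unfolding growth_above_def by blast
  have "\<exists>i j. exp (s2 * real n) / (K * K) \<le> real (mat_power A n $ i $ j)"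
  proof (rule ccontr)
    assume "\<not> ?thesis"
    then have *: "real (mat_power A n $ i $ j) < exp (s2 * real n) / (K * K)" for i j
      by (meson not_le)
    have "real (words_number A n) = (\<Sum>i\<in>UNIV. \<Sum>j\<in>UNIV. real (mat_power A n $ i $ j))"
      by (simp add: words_number_def)
    also have "\<dots> < (\<Sum>i\<in>(UNIV::'a set). \<Sum>j\<in>(UNIV::'a set). exp (s2 * real n) / (K * K))"
      by (intro sum_strict_mono *) auto
    also have "\<dots> = exp (s2 * real n)" using K by (simp add: K_def[symmetric])
    finally show False using n(2) by simp
  qed
  then obtain i j where ij: "exp (s2 * real n) / (K * K) \<le> real (mat_power A n $ i $ j)" by blast
  define L where "L = r b i + n + r j b"
  have "mat_power A n $ i $ j \<le> mat_power A (r b i) $ b $ i * mat_power A n $ i $ j * mat_power A (r j b) $ j $ b"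
    using r[of b i] r[of j b] by (simp add: Suc_le_eq)
  also have "\<dots> \<le> mat_power A (r b i + n) $ b $ j * mat_power A (r j b) $ j $ b"
    by (intro mult_right_mono mat_power_add_ge) auto
  also have "\<dots> \<le> mat_power A L $ b $ b"
    unfolding L_def by (rule mat_power_add_ge)
  finally have many: "mat_power A n $ i $ j \<le> mat_power A L $ b $ b" .
  have "ln (K * K) + 2 * real R * s1 \<le> (s2 - s1) * real n0"
    using n0 assms(4) by (simp add: field_simps)
  also have "\<dots> \<le> (s2 - s1) * real n" using n(1) assms(4) by (intro mult_left_mono) auto
  finally have "s1 * (real n + 2 * real R) + ln (K * K) \<le> s2 * real n"
    by (simp add: algebra_simps)
  moreover have "s1 * real L \<le> s1 * (real n + 2 * real R)"
    using R[of b i] R[of j b] assms(3) by (intro mult_left_mono) (auto simp: L_def)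
  ultimately have "s1 * real L \<le> s2 * real n - ln (K * K)" by linarith
  then have "exp (s1 * real L) \<le> exp (s2 * real n - ln (K * K))" by simp
  also have "\<dots> = exp (s2 * real n) / (K * K)"
    using K by (simp add: exp_diff)
  also have "\<dots> \<le> real (mat_power A L $ b $ b)" using ij many by linarith
  finally show ?thesis using n(1) by (intro exI[of _ L]) (auto simp: L_def)
qed

text \<open>
  Enlarging one loop length \<open>L0\<close> to a multiple \<open>L\<close>, in which all connections to \<open>b\<close> of length
  divisible by \<open>L0\<close> fit exactly, makes it unnecessary to treat the period of \<open>A\<close>.
\<close>

lemma ex_loop_length:
  fixes A :: "nat^'a::finite^'a"
  assumes "irreducible_matrix A" "growth_above A s2" "0 \<le> s1" "s1 < s2"
  obtains L where "L \<ge> N" "exp (s1 * real L) \<le> real (mat_power A L $ b $ b)"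
    and "\<And>d k. k > 0 \<Longrightarrow> mat_power A (k * L) $ d $ b > 0 \<Longrightarrow> mat_power A L $ d $ b > 0"
proof -
  obtain L0 where L0: "L0 \<ge> N" "exp (s1 * real L0) \<le> real (mat_power A L0 $ b $ b)"
    using ex_many_loops[OF assms, of N b] by blast
  have "real (mat_power A L0 $ b $ b) > 0"
    using L0(2) exp_gt_zero[of "s1 * real L0"] by linarith
  then have loop: "mat_power A L0 $ b $ b > 0" by simp
  have loops: "mat_power A (k * L0) $ b $ b > 0" for k
    using mat_power_mult_ge[of A L0 b k] loop by (meson less_le_trans zero_less_power)
  \<comment> \<open>For a state with no connection of this kind \<open>j d\<close> is arbitrary; it
    can only enlarge \<open>J\<close>. The \<open>Suc\<close> keeps \<open>J\<close> positive, so
    that \<open>J * L0 \<ge> N\<close>.\<close>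
  define j where "j d = (LEAST j. mat_power A (j * L0) $ d $ b > 0)" for d
  define J where "J = Suc (\<Sum>d\<in>UNIV. j d)"
  have J: "j d \<le> J" for d
    using member_le_sum[of d UNIV j] by (simp add: J_def)
  \<comment> \<open>A shortest connection takes \<open>j d\<close> units of length
    \<open>L0\<close>; the remaining \<open>J - j d\<close> units are spent on loops at
    \<open>b\<close>.\<close>
  have conn: "mat_power A (J * L0) $ d $ b > 0" if "mat_power A (k * L0) $ d $ b > 0" for d k
  proof -
    have "mat_power A (j d * L0) $ d $ b > 0" unfolding j_def by (rule LeastI) (rule that)
    then have "0 < mat_power A (j d * L0) $ d $ b * mat_power A ((J - j d) * L0) $ b $ b"
      using loops by simp
    also have "\<dots> \<le> mat_power A (j d * L0 + (J - j d) * L0) $ d $ b"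
      by (rule mat_power_add_ge)
    also have "j d * L0 + (J - j d) * L0 = J * L0"
      using J[of d] by (metis add_mult_distrib le_add_diff_inverse)
    finally show ?thesis .
  qed
  show ?thesis
  proof (rule that[of "J * L0"])
    show "J * L0 \<ge> N" using L0(1) by (simp add: J_def)
    have "exp (s1 * real (J * L0)) = exp (s1 * real L0) ^ J"
      by (simp only: exp_of_nat_mult[symmetric] of_nat_mult mult_ac)
    also have "\<dots> \<le> real (mat_power A L0 $ b $ b) ^ J" by (rule power_mono) (use L0 in auto)
    also have "\<dots> \<le> real (mat_power A (J * L0) $ b $ b)"
      using mat_power_mult_ge[of A L0 b J] by (simp only: of_nat_power[symmetric] of_nat_le_iff)
    finally show "exp (s1 * real (J * L0)) \<le> real (mat_power A (J * L0) $ b $ b)" .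
    show "mat_power A (J * L0) $ d $ b > 0" if "mat_power A (k * (J * L0)) $ d $ b > 0" for d k
      using conn[of "k * J" d] that by (simp only: mult.assoc)
  qed
qed

section \<open>A large set of Li--Yorke partners\<close>

lemma paths_nonempty_iff:
  assumes "zero_one_matrix A"
  shows "paths A n i j \<noteq> {} \<longleftrightarrow> mat_power A n $ i $ j > 0"
  using card_paths[OF assms, of n i j] finite_paths[of A n i j] by (metis card_gt_0_iff)

lemma infsum_cmult_right_ennreal:
  fixes c :: ennreal
  shows "(\<Sum>\<^sub>\<infinity>i\<in>I. c * f i) = c * (\<Sum>\<^sub>\<infinity>i\<in>I. f i)"
  by (simp add: nonneg_infsum_complete SUP_mult_left_ennreal sum_distrib_left)

lemma cylinderD: "x \<in> cylinder W \<Longrightarrow> i < length W \<Longrightarrow> x i = W ! i"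
  unfolding cylinder_def by (metis (mono_tags, lifting) add_0 diff_zero length_upt mem_Collect_eq nth_map nth_upt)

text \<open>The constant \<open>c\<close> does not depend on the cover, which keeps the Bowen
  measure at exponent \<open>s\<close> away from 0. It comes from applying
  \<open>cylinder_cover_weight_ge\<close> to independent choices of blocks from finite sets
  \<open>B k\<close>, each choice giving a Li--Yorke partner.\<close>

lemma sum_cover_LY_ge:
  fixes A :: "nat^'a::finite^'a" and \<omega> :: "nat \<Rightarrow> 'a"
  assumes A: "zero_one_matrix A" "irreducible_matrix A" and \<omega>: "\<omega> \<in> SFT A"
    and s: "0 \<le> s" "s < s3" and growth: "growth_above A s3"
  shows "\<exists>c>0. \<forall>C. LY rho (SFT A) shift \<omega> \<subseteq> (\<Union>W\<in>C. cylinder W) \<longrightarrow>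
           ennreal c \<le> (\<Sum>\<^sub>\<infinity>W\<in>C. ennreal (exp (- s * real (length W))))"
proof -
  \<comment> \<open>Three gaps: \<open>s3\<close> to \<open>s2\<close> pays for passing from words
    to loops, \<open>s2\<close> to \<open>s1\<close> for forbidding one loop in each free block, and
    \<open>s1\<close> to \<open>s\<close> for the blocks in \<open>F\<close>.\<close>
  define s1 where "s1 = s + (s3 - s) / 3"
  define s2 where "s2 = s + 2 * (s3 - s) / 3"
  have s12: "s < s1" "s1 < s2" "s2 < s3" "0 < s1" "0 < s2"
    using s by (auto simp: s1_def s2_def field_simps)
  obtain b where "infinite {n. \<omega> n = b}"
    using pigeonhole_infinite[of "UNIV :: nat set" \<omega>] by auto
  \<comment> \<open>For \<open>L\<close> beyond this \<open>N\<close> the number of loops is at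
    least \<open>2 * exp (s1 * L)\<close>, so removing one still leaves
    \<open>exp (s1 * L)\<close>.\<close>
  obtain N where N: "ln 2 / (s2 - s1) \<le> real N" using real_arch_simple by blast
  obtain L where L: "L \<ge> Suc N" "exp (s2 * real L) \<le> real (mat_power A L $ b $ b)"
    and conn: "\<And>d k. k > 0 \<Longrightarrow> mat_power A (k * L) $ d $ b > 0 \<Longrightarrow> mat_power A L $ d $ b > 0"
    using ex_loop_length[OF A(2) growth, of s2 "Suc N" b] s12 by auto
  have "L > 0" using L(1) by simp
  have "ln 2 \<le> (s2 - s1) * real N" using N s12 by (simp add: field_simps)
  also have "\<dots> \<le> (s2 - s1) * real L" using s12 L(1) by (intro mult_left_mono) auto
  finally have "s1 * real L + ln 2 \<le> s2 * real L" by (simp add: algebra_simps)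
  then have "exp (s1 * real L + ln 2) \<le> exp (s2 * real L)" by simp
  then have "exp (s1 * real L) * 2 \<le> exp (s2 * real L)" by (simp add: exp_add)
  moreover have "1 \<le> exp (s1 * real L)" using s12 by simp
  ultimately have many: "exp (s1 * real L) \<le> real (card (paths A L b b)) - 1"
    using L(2) unfolding card_paths[OF A(1)] by linarith

  \<comment> \<open>Pigeonhole on residues modulo \<open>L\<close>; the infinite class is
    represented by a visit \<open>t\<close> to \<open>b\<close>, where the block structure
    begins.\<close>
  obtain t where t: "\<omega> t = b" "infinite {n. \<omega> n = b \<and> n mod L = t mod L}"
  proof -
    have "finite ((\<lambda>n. n mod L) ` {n. \<omega> n = b})"
      by (rule finite_subset[of _ "{..<L}"]) (use \<open>L > 0\<close> in auto)
    then obtain t where "t \<in> {n. \<omega> n = b}" "infinite {n \<in> {n. \<omega> n = b}. n mod L = t mod L}"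
      using pigeonhole_infinite[OF \<open>infinite {n. \<omega> n = b}\<close>] by blast
    then show ?thesis using that[of t] by auto
  qed
  define S where "S = {k. \<omega> (t + k * L) = b}"
  have "infinite S"
  proof
    assume "finite S"
    have "{n. \<omega> n = b \<and> n mod L = t mod L} \<subseteq> {..t} \<union> (\<lambda>k. t + k * L) ` S"
    proof
      fix n assume n: "n \<in> {n. \<omega> n = b \<and> n mod L = t mod L}"
      show "n \<in> {..t} \<union> (\<lambda>k. t + k * L) ` S"
      proof (cases "n \<le> t")
        case False
        then have "L dvd n - t" using n by (simp add: mod_eq_dvd_iff_nat)
        then have eq: "n = t + ((n - t) div L) * L" using False by simp
        then have "(n - t) div L \<in> S" using n unfolding S_def mem_Collect_eq by metis
        with eq show ?thesis by blast
      qed simp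
    qed
    then show False using t(2) \<open>finite S\<close> by (meson finite_UnI finite_atMost finite_imageI finite_subset)
  qed

  \<comment> \<open>The density of \<open>F\<close> will be at most \<open>1 / q\<close>, hence at
    most \<open>(s1 - s) / s1\<close>; and \<open>q \<ge> 2\<close> leaves infinitely many blocks
    outside \<open>F\<close>.\<close>
  obtain q0 where q0: "s1 / (s1 - s) \<le> real q0" using real_arch_simple by blast
  define q where "q = max 2 q0"
  have "s1 / (s1 - s) \<le> real q" using q0 by (simp add: q_def)
  then have q: "s1 \<le> (s1 - s) * real q" "q \<ge> 2" using s12 by (auto simp: field_simps q_def)
  obtain F r where r: "\<And>n. r n \<ge> n" "\<And>n. {r n..r n + n} \<subseteq> F"
    and enter: "\<And>k. k \<notin> F \<Longrightarrow> Suc k \<in> F \<Longrightarrow> Suc k \<in> S"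
    and sparse: "\<And>n. q * card (F \<inter> {..<n}) \<le> n"
    using ex_sparse_set[OF \<open>infinite S\<close>, of q] q(2) by (metis less_le_trans zero_less_numeral)

  txt \<open>
    On a run of consecutive blocks in \<open>F\<close> the orbit of \<open>\<omega>\<close> is copied, and the last block of the run
    leads back to \<open>b\<close>. Off \<open>F\<close> any loop at \<open>b\<close> is allowed except the block of \<open>\<omega>\<close> itself.
\<close>
  define copy where "copy k = block \<omega> (t + k * L) L" for k
  \<comment> \<open>The starting state of block \<open>k\<close>. Runs of \<open>F\<close> begin
    only at indices in \<open>S\<close>, where \<open>\<omega>\<close> is at \<open>b\<close>, so a
    free loop can precede such a run.\<close>
  define e where "e k = (if k \<in> F then \<omega> (t + k * L) else b)" for k
  define B where "B k = (if k \<in> F then (if Suc k \<in> F then {copy k} else paths A L (e k) b)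
      else paths A L b b - {copy k})" for k
  have B_paths: "B k \<subseteq> paths A L (e k) (e (Suc k))" for k
  proof (cases "k \<in> F")
    case True
    have "copy k \<in> paths A L (\<omega> (t + k * L)) (\<omega> (t + k * L + L))"
      unfolding copy_def using \<omega> by (rule block_in_paths)
    then show ?thesis using True by (auto simp: B_def e_def add_ac)
  next
    case False
    then show ?thesis using enter[of k] by (auto simp: B_def e_def S_def add_ac)
  qed
  have B_fin: "finite (B k)" for k
    using B_paths finite_paths by (rule finite_subset)
  have B_free: "exp (s1 * real L) \<le> real (card (B k))" if "k \<notin> F" for k
  proof -
    have "real (card (paths A L b b)) - 1 \<le> real (card (paths A L b b - {copy k}))"
      using diff_card_le_card_Diff[of "{copy k}" "paths A L b b"] by simp
    then show ?thesis using many that by (simp add: B_def)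
  qed
  have B_ne: "B k \<noteq> {}" for k
  proof (cases "k \<in> F")
    case True
    \<comment> \<open>A later visit of \<open>\<omega>\<close> to \<open>b\<close> gives a
      connection whose length is a multiple of \<open>L\<close>; by \<open>conn\<close> there is
      then one of length exactly \<open>L\<close>.\<close>
    obtain k' where "k' > k" "k' \<in> S"
      using \<open>infinite S\<close> by (auto simp: infinite_nat_iff_unbounded)
    then have "block \<omega> (t + k * L) ((k' - k) * L) \<in> paths A ((k' - k) * L) (\<omega> (t + k * L)) b"
      using block_in_paths[OF \<omega>, of "t + k * L" "(k' - k) * L"]
      by (simp add: S_def algebra_simps)
    then have "mat_power A ((k' - k) * L) $ \<omega> (t + k * L) $ b > 0"
      using paths_nonempty_iff[OF A(1)] by blast
    then have "mat_power A L $ \<omega> (t + k * L) $ b > 0"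
      using conn[of "k' - k"] \<open>k' > k\<close> by simp
    then show ?thesis using True paths_nonempty_iff[OF A(1)] by (auto simp: B_def e_def)
  next
    case False
    then have "card (B k) \<noteq> 0" using B_free[of k] by (metis exp_gt_zero of_nat_0 not_le)
    then show ?thesis by auto
  qed

  define \<Phi> where "\<Phi> x = splice_blocks \<omega> t L x" for x :: "nat \<Rightarrow> 'a list"
  have block_\<Phi>: "block (\<Phi> x) (t + k * L) L = x k" if "\<And>k. x k \<in> B k" for x k
    unfolding \<Phi>_def using that[of k] B_paths[of k]
    by (intro block_splice_blocks) (auto simp: paths_def)
  have \<Phi>_LY: "\<Phi> x \<in> LY rho (SFT A) shift \<omega>" if x: "\<And>k. x k \<in> B k" for x
  proof -
    have "\<Phi> x \<in> SFT A" unfolding \<Phi>_def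
    proof (rule splice_blocks_in_SFT[where e = e])
      show "x k \<in> paths A L (e k) (e (Suc k))" for k using x B_paths by blast
    qed (use \<omega> \<open>L > 0\<close> t(1) in \<open>auto simp: e_def\<close>)
    moreover have "li_yorke_pair rho shift \<omega> (\<Phi> x)"
    proof (rule li_yorke_pair_rhoI)
      fix m
      have "\<omega> (t + r m * L + i) = \<Phi> x (t + r m * L + i)" if "i < m" for i
      proof -
        \<comment> \<open>The index of the block containing this position. \<open>Suc k\<close> must
          also lie in \<open>F\<close>, since the last block of a run need not be a copy;
          \<open>i < m\<close> leaves room for it.\<close>
        define k where "k = r m + i div L"
        have "i div L \<le> i" by simp
        then have "k \<in> {r m..r m + m}" "Suc k \<in> {r m..r m + m}" using that by (auto simp: k_def simp del: div_le_dividend)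
        then have "k \<in> F" "Suc k \<in> F" using r(2) by blast+
        then have "x k = copy k" using x[of k] by (simp add: B_def)
        moreover have "x k ! (i mod L) = \<Phi> x (t + k * L + i mod L)"
          unfolding \<Phi>_def using \<open>L > 0\<close> by (subst splice_blocks_nth) auto
        moreover have "copy k ! (i mod L) = \<omega> (t + k * L + i mod L)"
          using \<open>L > 0\<close> by (simp add: copy_def block_def)
        moreover have "t + k * L + i mod L = t + r m * L + i"
          by (simp add: k_def algebra_simps)
        ultimately show ?thesis by metis
      qed
      moreover have "m \<le> t + r m * L"
        using r(1)[of m] \<open>L > 0\<close> by (metis (full_types) One_nat_def Suc_leI le_trans mult.right_neutral mult_le_mono2 trans_le_add2)
      ultimately show "\<exists>n\<ge>m. \<forall>i<m. \<omega> (n + i) = \<Phi> x (n + i)" by blast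
    next
      fix m
      have "\<exists>k\<ge>m. k \<notin> F"
      proof (rule ccontr)
        assume "\<not> ?thesis"
        \<comment> \<open>If \<open>F\<close> contained everything from \<open>m\<close> on, it
          would have at least \<open>m + 1\<close> elements below \<open>2 * m + 1\<close>, which
          sparsity with \<open>q \<ge> 2\<close> forbids.\<close>
        then have "{m..<2 * m + 1} \<subseteq> F \<inter> {..<2 * m + 1}" by auto
        from card_mono[OF _ this] have "m + 1 \<le> card (F \<inter> {..<2 * m + 1})" by simp
        then have "q * (m + 1) \<le> q * card (F \<inter> {..<2 * m + 1})" by (rule mult_left_mono) simp
        then have "q * (m + 1) \<le> 2 * m + 1" using sparse[of "2 * m + 1"] by linarith
        moreover have "2 * (m + 1) \<le> q * (m + 1)" using q(2) by (intro mult_right_mono) auto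
        ultimately show False by simp
      qed
      then obtain k where k: "k \<ge> m" "k \<notin> F" by blast
      then have "block (\<Phi> x) (t + k * L) L \<noteq> copy k"
        using block_\<Phi>[OF x] x[of k] by (auto simp: B_def)
      then obtain n where "n \<ge> t + k * L" "\<omega> n \<noteq> \<Phi> x n"
        unfolding copy_def block_def by fastforce
      moreover have "t + k * L \<ge> m"
        using k(1) \<open>L > 0\<close> by (metis (full_types) One_nat_def Suc_leI le_trans mult.right_neutral mult_le_mono2 trans_le_add2)
      ultimately show "\<exists>n\<ge>m. \<omega> n \<noteq> \<Phi> x n" by (meson le_trans)
    qed
    ultimately show ?thesis by (simp add: LY_def)
  qed

  \<comment> \<open>Factors in \<open>F\<close> are bounded by 1, the others by
    \<open>exp (- s1 * L)\<close>; the density of \<open>F\<close> is low enough for the free blocks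
    alone to give exponent \<open>s\<close>.\<close>
  have weight: "(\<Prod>k<n. 1 / real (card (B k))) \<le> exp (- s * real (n * L))" for n
  proof -
    have pos: "real (card (B k)) \<ge> 1" for k
      using B_fin B_ne by (simp add: Suc_le_eq card_gt_0_iff)
    have "(\<Prod>k<n. 1 / real (card (B k))) \<le> (\<Prod>k<n. if k \<in> F then 1 else exp (- s1 * real L))"
    proof (rule prod_mono)
      fix k
      have "1 / real (card (B k)) \<le> exp (- s1 * real L)" if "k \<notin> F"
        using le_imp_inverse_le[OF B_free[OF that]] by (simp add: exp_minus inverse_eq_divide)
      then show "0 \<le> 1 / real (card (B k)) \<and>
          1 / real (card (B k)) \<le> (if k \<in> F then 1 else exp (- s1 * real L))"
        using pos[of k] by auto
    qed
    also have "\<dots> = exp (- s1 * real L) ^ card ({..<n} - F)"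
      by (subst prod.If_cases) (auto simp: Diff_eq)
    also have "\<dots> = exp (- (s1 * real (card ({..<n} - F))) * real L)"
      by (simp add: exp_of_nat_mult[symmetric] mult_ac)
    also have "\<dots> \<le> exp (- s * real (n * L))"
    proof -
      have "card ({..<n} - F) = n - card (F \<inter> {..<n})"
        by (subst card_Diff_subset_Int) (auto simp: Int_commute)
      moreover have "card (F \<inter> {..<n}) \<le> n" using card_mono[of "{..<n}" "F \<inter> {..<n}"] by simp
      ultimately have c: "real (card ({..<n} - F)) = real n - real (card (F \<inter> {..<n}))" by simp
      have "s1 * real (card (F \<inter> {..<n})) \<le> (s1 - s) * real q * real (card (F \<inter> {..<n}))"
        using q(1) by (intro mult_right_mono) auto
      also have "\<dots> = (s1 - s) * real (q * card (F \<inter> {..<n}))" by simp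
      also have "\<dots> \<le> (s1 - s) * real n"
        using sparse[of n] s12 by (intro mult_left_mono) (auto simp del: of_nat_mult)
      finally have "s * real n \<le> s1 * real (card ({..<n} - F))"
        by (simp add: c algebra_simps)
      then have "s * real n * real L \<le> s1 * real (card ({..<n} - F)) * real L"
        by (rule mult_right_mono) simp
      then show ?thesis by simp
    qed
    finally show ?thesis .
  qed

  \<comment> \<open>\<open>t + L\<close> bounds the letters of a word outside its complete blocks:
    the prefix and a partial last block.\<close>
  define c where "c = exp (- s * real (t + L))"
  have "ennreal c \<le> (\<Sum>\<^sub>\<infinity>W\<in>C. ennreal (exp (- s * real (length W))))"
    if C: "LY rho (SFT A) shift \<omega> \<subseteq> (\<Union>W\<in>C. cylinder W)" for C
  proof -
    \<comment> \<open>Only cover words met by some \<open>\<Phi> x\<close> matter;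
      \<open>X W\<close> picks such an \<open>x\<close>, and \<open>v W\<close> lists its blocks
      lying entirely inside \<open>W\<close>. A word shorter than \<open>t\<close> gets the empty
      list by truncated subtraction.\<close>
    define I where "I = {W \<in> C. \<exists>x. (\<forall>k. x k \<in> B k) \<and> \<Phi> x \<in> cylinder W}"
    define X where "X W = (SOME x. (\<forall>k. x k \<in> B k) \<and> \<Phi> x \<in> cylinder W)" for W
    have X: "X W k \<in> B k" "\<Phi> (X W) \<in> cylinder W" if "W \<in> I" for W k
    proof -
      have "\<exists>x. (\<forall>k. x k \<in> B k) \<and> \<Phi> x \<in> cylinder W" using that by (simp add: I_def)
      from someI_ex[OF this] show "X W k \<in> B k" "\<Phi> (X W) \<in> cylinder W"
        unfolding X_def by auto
    qed
    define v where "v W = map (X W) [0..<(length W - t) div L]" for W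
    have len_v: "length (v W) = (length W - t) div L" for W by (simp add: v_def)
    have "1 \<le> (\<Sum>\<^sub>\<infinity>W\<in>I. ennreal (\<Prod>k<length (v W). 1 / real (card (B k))))"
    proof (rule cylinder_cover_weight_ge)
      fix x assume x: "\<And>k. x k \<in> B k"
      obtain W where W: "W \<in> C" "\<Phi> x \<in> cylinder W" using C \<Phi>_LY[OF x] by blast
      then have "W \<in> I" unfolding I_def using x by blast
      \<comment> \<open>Two points of one cylinder agree on every block that the word contains
        completely.\<close>
      have "x k = X W k" if "k < (length W - t) div L" for k
      proof -
        have "Suc k * L \<le> (length W - t) div L * L" using that by (intro mult_right_mono) auto
        also have "\<dots> \<le> length W - t" by simp
        finally have le: "t + k * L + L \<le> length W" using \<open>L > 0\<close> by simp
        have "\<Phi> x i = \<Phi> (X W) i" if "i < length W" for i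
          using cylinderD[OF W(2) that] cylinderD[OF X(2)[OF \<open>W \<in> I\<close>] that] by simp
        then have "block (\<Phi> x) (t + k * L) L = block (\<Phi> (X W)) (t + k * L) L"
          using le by (auto simp: block_def)
        then show ?thesis using block_\<Phi>[OF x] block_\<Phi>[OF X(1)[OF \<open>W \<in> I\<close>]] by simp
      qed
      then have "map x [0..<length (v W)] = v W"
        unfolding len_v by (simp add: v_def)
      then show "\<exists>W\<in>I. map x [0..<length (v W)] = v W" using \<open>W \<in> I\<close> by blast
    qed (use B_fin B_ne in auto)
    also have "\<dots> \<le> (\<Sum>\<^sub>\<infinity>W\<in>I. ennreal (1 / c) * ennreal (exp (- s * real (length W))))"
    proof (rule infsum_mono)
      fix W :: "'a list"
      define n where "n = (length W - t) div L"
      have "length W - t = n * L + (length W - t) mod L" by (simp add: n_def)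
      moreover have "(length W - t) mod L < L" using \<open>L > 0\<close> by simp
      ultimately have "length W \<le> n * L + (t + L)" by linarith
      then have "real (length W) \<le> real (n * L) + real (t + L)"
        by (metis of_nat_add of_nat_le_iff)
      then have "s * real (length W) \<le> s * (real (n * L) + real (t + L))"
        using s(1) by (rule mult_left_mono)
      then have "- s * real (n * L) \<le> - (- s * real (t + L)) + - s * real (length W)"
        by (simp add: distrib_left)
      then have "exp (- s * real (n * L)) \<le> exp (- (- s * real (t + L)) + - s * real (length W))"
        by (simp only: exp_le_cancel_iff)
      also have "\<dots> = 1 / c * exp (- s * real (length W))"
        unfolding c_def exp_add exp_minus[of "- s * real (t + L)"] by (simp add: inverse_eq_divide)
      finally have "(\<Prod>k<length (v W). 1 / real (card (B k))) \<le> 1 / c * exp (- s * real (length W))"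
        using weight[of n] by (simp add: len_v n_def)
      then have "ennreal (\<Prod>k<length (v W). 1 / real (card (B k))) \<le> ennreal (1 / c * exp (- s * real (length W)))"
        by (rule ennreal_leI)
      also have "\<dots> = ennreal (1 / c) * ennreal (exp (- s * real (length W)))"
        by (rule ennreal_mult) (auto simp: c_def)
      finally show "ennreal (\<Prod>k<length (v W). 1 / real (card (B k))) \<le>
          ennreal (1 / c) * ennreal (exp (- s * real (length W)))" .
    qed (auto intro: nonneg_summable_on_complete)
    also have "\<dots> \<le> (\<Sum>\<^sub>\<infinity>W\<in>C. ennreal (1 / c) * ennreal (exp (- s * real (length W))))"
      by (rule infsum_mono_neutral) (auto simp: I_def intro: nonneg_summable_on_complete)
    also have "\<dots> = ennreal (1 / c) * (\<Sum>\<^sub>\<infinity>W\<in>C. ennreal (exp (- s * real (length W))))"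
      by (rule infsum_cmult_right_ennreal)
    finally have "ennreal c * 1 \<le> ennreal c * (ennreal (1 / c) * (\<Sum>\<^sub>\<infinity>W\<in>C. ennreal (exp (- s * real (length W)))))"
      by (rule mult_left_mono) simp
    also have "\<dots> = ennreal (c * (1 / c)) * (\<Sum>\<^sub>\<infinity>W\<in>C. ennreal (exp (- s * real (length W))))"
      by (subst ennreal_mult) (auto simp: c_def mult.assoc)
    finally show ?thesis by (simp add: c_def)
  qed
  moreover have "c > 0" by (simp add: c_def)
  ultimately show ?thesis by blast
qed

section \<open>Bowen entropy and Hausdorff dimension\<close>

text \<open>Raising \<open>N\<close> leaves fewer admissible covers, so the infima increase with
  \<open>N\<close>.\<close>

lemma bowen_measure_eq_SUP: "bowen_measure s Z = (SUP N. bowen_pre s N Z)"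
proof -
  have "incseq (\<lambda>N. bowen_pre s N Z)"
    unfolding bowen_pre_def by (intro incseq_SucI INF_superset_mono) auto
  then show ?thesis unfolding bowen_measure_def by (intro limI LIMSEQ_SUP)
qed

lemma ennreal_eq_0_iff_less:
  fixes x :: ennreal
  shows "x = 0 \<longleftrightarrow> (\<forall>\<eta>>0. x < ennreal \<eta>)"
proof
  assume *: "\<forall>\<eta>>0. x < ennreal \<eta>"
  show "x = 0"
  proof (rule ccontr)
    assume "x \<noteq> 0"
    moreover have "x < top" using * by (metis ennreal_less_top less_trans zero_less_one)
    ultimately have "enn2real x > 0" "ennreal (enn2real x) = x"
      by (auto simp: enn2real_positive_iff zero_less_iff_neq_zero)
    then show False using *[rule_format, of "enn2real x"] by simp
  qed
qed auto

lemma bowen_measure_eq_0_iff: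
  "bowen_measure s Z = 0 \<longleftrightarrow> (\<forall>N. \<forall>\<eta>>0. \<exists>C. Z \<subseteq> (\<Union>W\<in>C. cylinder W) \<and> (\<forall>W\<in>C. length W > N) \<and>
     (\<Sum>\<^sub>\<infinity>W\<in>C. ennreal (exp (- s * real (length W)))) < ennreal \<eta>)"
proof -
  have "bowen_measure s Z = 0 \<longleftrightarrow> (\<forall>N. bowen_pre s N Z = 0)"
    unfolding bowen_measure_eq_SUP bot_ennreal[symmetric] SUP_bot_conv(1) by simp
  then show ?thesis
    unfolding ennreal_eq_0_iff_less bowen_pre_def INF_less_iff by (simp add: conj_assoc Bex_def)
qed

lemma hausdorff_measure_eq_0_iff:
  "hausdorff_measure d s Z = 0 \<longleftrightarrow> (\<forall>\<delta>>0. \<forall>\<eta>>0. \<exists>U. Z \<subseteq> (\<Union>n::nat. U n) \<and>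
     (\<forall>n. set_diam d (U n) \<le> ennreal \<delta>) \<and> (\<Sum>n. diam_powr d s (U n)) < ennreal \<eta>)"
proof -
  have "hausdorff_measure d s Z = 0 \<longleftrightarrow> (\<forall>\<delta>>0. hausdorff_pre d s \<delta> Z = 0)"
    unfolding hausdorff_measure_def bot_ennreal[symmetric] SUP_bot_conv(1) by auto
  then show ?thesis
    unfolding ennreal_eq_0_iff_less hausdorff_pre_def INF_less_iff by (simp add: conj_assoc Bex_def)
qed

section \<open>Comparison of cylinder covers with metric covers\<close>

lemma suminf_eq_infsum_ennreal:
  fixes f :: "nat \<Rightarrow> ennreal"
  shows "(\<Sum>n. f n) = infsum f UNIV"
proof -
  have "(f has_sum infsum f UNIV) UNIV"
    by (intro has_sum_infsum nonneg_summable_on_complete) simp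
  then show ?thesis using has_sum_imp_sums sums_unique by metis
qed

lemma infsum_image_le_ennreal:
  fixes f :: "'b \<Rightarrow> ennreal"
  shows "infsum f (g ` I) \<le> infsum (f \<circ> g) I"
proof -
  obtain J where J: "J \<subseteq> I" "inj_on g J" "g ` I = g ` J"
    using subset_image_inj[of "g ` I" g I] by auto
  have "infsum f (g ` J) = infsum (f \<circ> g) J" using J(2) by (rule infsum_reindex)
  also have "\<dots> \<le> infsum (f \<circ> g) I"
    by (rule infsum_mono_neutral) (use J(1) in \<open>auto intro: nonneg_summable_on_complete\<close>)
  finally show ?thesis using J(3) by simp
qed

lemma power_eq_exp_ln:
  assumes "K > (0::real)"
  shows "((1 / K) ^ m) powr s = exp (- (s * ln K) * real m)"
  using assms by (simp add: powr_def ln_realpow ln_div)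

lemma set_diam_cylinder_le:
  fixes U :: "(nat \<Rightarrow> 'a::finite) set"
  assumes "\<And>x y i. x \<in> U \<Longrightarrow> y \<in> U \<Longrightarrow> i < m \<Longrightarrow> x i = y i"
  shows "set_diam rho U \<le> ennreal ((1 / real CARD('a)) ^ m)"
  unfolding set_diam_def
proof (intro SUP_least ennreal_leI)
  fix x y assume xy: "x \<in> U" "y \<in> U"
  show "rho x y \<le> (1 / real CARD('a)) ^ m"
  proof (cases "x = y")
    case False
    then obtain n where n: "x n \<noteq> y n" "\<And>i. i < n \<Longrightarrow> x i = y i"
      by (rule ex_first_difference) blast
    then have "m \<le> n" using assms[OF xy] not_less by blast
    then show ?thesis
      using rho_first_difference[of x n y, OF n]
        power_decreasing[of m n "1 / real CARD('a)"] by simp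
  qed (simp add: rho_def)
qed

text \<open>With K letters, a cylinder of length \<open>m\<close> has diameter at most K to the
  power -m, so its \<open>s\<close>-th power is at most the Bowen weight at exponent
  \<open>s * ln K\<close>.\<close>

lemma hausdorff_null_if_bowen_null:
  fixes Z :: "(nat \<Rightarrow> 'a::finite) set"
  assumes K: "CARD('a) \<ge> 2" and "0 \<le> s" and null: "bowen_measure (s * ln (real CARD('a))) Z = 0"
  shows "hausdorff_measure rho s Z = 0"
  unfolding hausdorff_measure_eq_0_iff
proof (intro allI impI)
  fix \<delta> \<eta> :: real assume "\<delta> > 0" "\<eta> > 0"
  let ?K = "real CARD('a)"
  define f where "f W = ennreal (exp (- (s * ln ?K) * real (length W)))" for W :: "'a list"
  obtain N where N: "(1 / ?K) ^ N < \<delta>"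
    using real_arch_pow_inv[of \<delta> "1 / ?K"] \<open>\<delta> > 0\<close> K by auto
  obtain C where C: "Z \<subseteq> (\<Union>W\<in>C. cylinder W)" "\<forall>W\<in>C. length W > N" "infsum f C < ennreal \<eta>"
    using null[unfolded bowen_measure_eq_0_iff, THEN spec, of N, THEN spec, of \<eta>] \<open>\<eta> > 0\<close>
    unfolding f_def by blast
  have "countable (UNIV :: 'a list set)"
    using countable_lists[of "UNIV :: 'a set"] by (simp add: countable_finite)
  then obtain g :: "'a list \<Rightarrow> nat" where g: "inj g"
    by (rule countableE)
  define U where "U n = {x. \<exists>W\<in>C. g W = n \<and> x \<in> cylinder W}" for n
  have U_g: "U (g W) \<subseteq> cylinder W" for W using g by (auto simp: U_def inj_eq)
  have U_empty: "U n = {}" if "n \<notin> g ` C" for n using that by (auto simp: U_def)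
  have diam: "set_diam rho (U (g W)) \<le> ennreal ((1 / ?K) ^ length W)" for W
  proof (rule set_diam_cylinder_le)
    fix x y i assume "x \<in> U (g W)" "y \<in> U (g W)" "i < length W"
    then show "x i = y i" using U_g cylinderD by (metis subsetD)
  qed
  have "diam_powr rho s (U (g W)) \<le> f W" for W
  proof (cases "s = 0")
    case False
    have "enn2real (set_diam rho (U (g W))) \<le> (1 / ?K) ^ length W"
      by (rule enn2real_leI[OF _ diam]) simp
    then have "enn2real (set_diam rho (U (g W))) powr s \<le> ((1 / ?K) ^ length W) powr s"
      using \<open>0 \<le> s\<close> by (intro powr_mono2) auto
    then show ?thesis
      using K by (simp only: f_def diam_powr_def power_eq_exp_ln) (auto simp: False intro: ennreal_leI)
  qed (simp add: f_def diam_powr_def)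
  then have "infsum (diam_powr rho s \<circ> U \<circ> g) C \<le> infsum f C"
    by (intro infsum_mono nonneg_summable_on_complete) auto
  moreover have "infsum (diam_powr rho s \<circ> U \<circ> g) C = infsum (diam_powr rho s \<circ> U) (g ` C)"
    by (rule infsum_reindex[symmetric]) (use g in \<open>auto intro: inj_on_subset\<close>)
  moreover have "\<dots> = (\<Sum>n. diam_powr rho s (U n))"
    unfolding suminf_eq_infsum_ennreal
    by (rule infsum_cong_neutral) (use U_empty in \<open>auto simp: diam_powr_def\<close>)
  ultimately have "(\<Sum>n. diam_powr rho s (U n)) < ennreal \<eta>" using C(3) by simp
  moreover have "set_diam rho (U n) \<le> ennreal \<delta>" for n
  proof (cases "n \<in> g ` C")
    case True
    then obtain W where W: "W \<in> C" "n = g W" by blast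
    have "(1 / ?K) ^ length W \<le> (1 / ?K) ^ N"
      using C(2) W(1) K by (intro power_decreasing) auto
    then show ?thesis unfolding W(2) using diam[of W] N
      by (meson ennreal_leI less_imp_le order_trans)
  qed (simp add: U_empty set_diam_def bot_ennreal)
  moreover have "Z \<subseteq> (\<Union>n. U n)" using C(1) unfolding U_def by blast
  ultimately show "\<exists>U. Z \<subseteq> (\<Union>n. U n) \<and> (\<forall>n. set_diam rho (U n) \<le> ennreal \<delta>) \<and>
      (\<Sum>n. diam_powr rho s (U n)) < ennreal \<eta>" by blast
qed

text \<open>If \<open>U\<close> has two points, its longest common prefix has a length
  \<open>m\<close> such that the diameter is at least K to the power -m, with K letters. A singleton
  has diameter 0, and the allowance \<open>\<epsilon>\<close> pays for a long cylinder around
  it.\<close>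

lemma ex_enclosing_cylinder:
  fixes U :: "(nat \<Rightarrow> 'a::finite) set"
  assumes K: "CARD('a) \<ge> 2" and "0 \<le> s" "\<epsilon> > 0" "U \<noteq> {}"
    and diam: "set_diam rho U \<le> ennreal ((1 / real CARD('a)) ^ Suc N)"
  shows "\<exists>W. length W > N \<and> U \<subseteq> cylinder W \<and>
    ennreal (exp (- (s * ln (real CARD('a))) * real (length W))) \<le> diam_powr rho s U + ennreal \<epsilon>"
proof -
  let ?K = "real CARD('a)"
  have dist: "ennreal (rho x y) \<le> set_diam rho U" if "x \<in> U" "y \<in> U" for x y
    unfolding set_diam_def using that by (meson SUP_upper SUP_upper2)
  obtain x where x: "x \<in> U" using \<open>U \<noteq> {}\<close> by blast
  have lnK: "ln ?K > 0" using K by simp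
  show ?thesis
  proof (cases "U = {x}")
    case True
    obtain m where m: "m > N" "ennreal (exp (- (s * ln ?K) * real m)) \<le> diam_powr rho s U + ennreal \<epsilon>"
    proof (cases "s = 0")
      case True
      then show ?thesis using that[of "Suc N"] \<open>U \<noteq> {}\<close> by (simp add: diam_powr_def)
    next
      case False
      then have pos: "s * ln ?K > 0" using lnK \<open>0 \<le> s\<close> by simp
      obtain m0 where m0: "- ln \<epsilon> / (s * ln ?K) \<le> real m0" using real_arch_simple by blast
      define m where "m = max m0 (Suc N)"
      have "- ln \<epsilon> / (s * ln ?K) \<le> real m" using m0 by (simp add: m_def)
      then have "- ln \<epsilon> \<le> (s * ln ?K) * real m" using pos by (simp add: field_simps)
      then have "exp (- (s * ln ?K) * real m) \<le> exp (ln \<epsilon>)" by simp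
      then have "exp (- (s * ln ?K) * real m) \<le> \<epsilon>" using \<open>\<epsilon> > 0\<close> by simp
      then have "ennreal (exp (- (s * ln ?K) * real m)) \<le> 0 + ennreal \<epsilon>"
        using ennreal_leI by simp
      also have "\<dots> \<le> diam_powr rho s U + ennreal \<epsilon>" by (rule add_right_mono) simp
      finally show ?thesis using that[of m] by (simp add: m_def)
    qed
    have "U \<subseteq> cylinder (block x 0 m)" using True by (simp add: cylinder_def block_def)
    then show ?thesis using m by (intro exI[of _ "block x 0 m"]) (simp add: block_def)
  next
    case False
    \<comment> \<open>The first coordinate at which some point of \<open>U\<close> departs from
      \<open>x\<close>; before it all points of \<open>U\<close> agree.\<close>
    define m where "m = (LEAST i. \<exists>y\<in>U. x i \<noteq> y i)"
    obtain z where "z \<in> U" "x \<noteq> z" using False x by blast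
    then have "\<exists>i. \<exists>y\<in>U. x i \<noteq> y i" by (meson ext)
    then have "\<exists>y\<in>U. x m \<noteq> y m" unfolding m_def by (rule LeastI_ex)
    then obtain y where y: "y \<in> U" "x m \<noteq> y m" by blast
    have agree: "x i = z i" if "z \<in> U" "i < m" for z i
      using not_less_Least[of i "\<lambda>i. \<exists>y\<in>U. x i \<noteq> y i"] that unfolding m_def by blast
    have "rho x y = (1 / ?K) ^ m" using y agree by (intro rho_first_difference) auto
    then have le: "ennreal ((1 / ?K) ^ m) \<le> set_diam rho U" using dist[OF x y(1)] by simp
    then have "ennreal ((1 / ?K) ^ m) \<le> ennreal ((1 / ?K) ^ Suc N)" using diam by (rule order_trans)
    then have "(1 / ?K) ^ m \<le> (1 / ?K) ^ Suc N" by (simp add: ennreal_le_iff del: power_Suc)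
    then have "m > N" using K power_decreasing_iff[of "1 / ?K" m "Suc N"] by (simp del: power_Suc)
    moreover have "U \<subseteq> cylinder (block x 0 m)"
      using agree by (auto simp: cylinder_def block_def)
    moreover have "ennreal (exp (- (s * ln ?K) * real m)) \<le> diam_powr rho s U"
    proof (cases "s = 0")
      case False
      have "set_diam rho U < top" using diam by (meson ennreal_less_top le_less_trans)
      then have "(1 / ?K) ^ m \<le> enn2real (set_diam rho U)"
        using le by (metis enn2real_ennreal enn2real_mono zero_le_divide_1_iff of_nat_0_le_iff zero_le_power)
      then have "((1 / ?K) ^ m) powr s \<le> enn2real (set_diam rho U) powr s"
        using \<open>0 \<le> s\<close> by (intro powr_mono2) auto
      then have "exp (- (s * ln ?K) * real m) \<le> enn2real (set_diam rho U) powr s"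
        using K by (simp only: power_eq_exp_ln)
      then show ?thesis
        using \<open>U \<noteq> {}\<close> False unfolding diam_powr_def by (simp only: if_False) (rule ennreal_leI)
    qed (use \<open>U \<noteq> {}\<close> in \<open>simp add: diam_powr_def\<close>)
    ultimately show ?thesis
      by (intro exI[of _ "block x 0 m"]) (auto simp: block_def intro: add_increasing2)
  qed
qed

lemma bowen_null_if_hausdorff_null:
  fixes Z :: "(nat \<Rightarrow> 'a::finite) set"
  assumes K: "CARD('a) \<ge> 2" and "0 \<le> s" and null: "hausdorff_measure rho s Z = 0"
  shows "bowen_measure (s * ln (real CARD('a))) Z = 0"
  unfolding bowen_measure_eq_0_iff
proof (intro allI impI)
  fix N and \<eta> :: real assume "\<eta> > 0"
  let ?K = "real CARD('a)"
  define f where "f W = ennreal (exp (- (s * ln ?K) * real (length W)))" for W :: "'a list"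
  have "(1 / ?K) ^ Suc N > 0" "\<eta> / 2 > 0" using \<open>\<eta> > 0\<close> by simp_all
  then obtain U where U: "Z \<subseteq> (\<Union>n::nat. U n)" "\<forall>n. set_diam rho (U n) \<le> ennreal ((1 / ?K) ^ Suc N)"
    "(\<Sum>n. diam_powr rho s (U n)) < ennreal (\<eta> / 2)"
    using null[unfolded hausdorff_measure_eq_0_iff, THEN spec, of "(1 / ?K) ^ Suc N", THEN mp,
      THEN spec, of "\<eta> / 2"] by blast
  \<comment> \<open>These allowances sum to \<open>\<eta> / 2\<close>.\<close>
  define \<epsilon> where "\<epsilon> n = \<eta> / 2 * (1 / 2) ^ Suc n" for n
  have "\<epsilon> n > 0" for n using \<open>\<eta> > 0\<close> by (simp add: \<epsilon>_def)
  then have "\<forall>n. \<exists>W. U n \<noteq> {} \<longrightarrow> length W > N \<and> U n \<subseteq> cylinder W \<and> f W \<le> diam_powr rho s (U n) + ennreal (\<epsilon> n)"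
    using ex_enclosing_cylinder[OF K \<open>0 \<le> s\<close>] U(2) unfolding f_def by metis
  then obtain w where w: "\<And>n. U n \<noteq> {} \<Longrightarrow> length (w n) > N" "\<And>n. U n \<noteq> {} \<Longrightarrow> U n \<subseteq> cylinder (w n)"
    "\<And>n. U n \<noteq> {} \<Longrightarrow> f (w n) \<le> diam_powr rho s (U n) + ennreal (\<epsilon> n)" by metis
  let ?I = "{n. U n \<noteq> {}}"
  have "infsum f (w ` ?I) \<le> infsum (f \<circ> w) ?I" by (rule infsum_image_le_ennreal)
  also have "\<dots> \<le> (\<Sum>\<^sub>\<infinity>n\<in>UNIV. diam_powr rho s (U n) + ennreal (\<epsilon> n))"
    by (rule infsum_mono_neutral) (use w(3) in \<open>auto intro: nonneg_summable_on_complete\<close>)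
  also have "\<dots> = (\<Sum>n. diam_powr rho s (U n)) + (\<Sum>n. ennreal (\<epsilon> n))"
    unfolding suminf_eq_infsum_ennreal[symmetric] by (rule suminf_add[symmetric]) simp_all
  also have "(\<Sum>n. ennreal (\<epsilon> n)) = ennreal (\<eta> / 2)"
  proof (rule suminf_ennreal_eq)
    show "\<epsilon> sums (\<eta> / 2)"
      unfolding \<epsilon>_def using sums_mult[OF power_half_series, of "\<eta> / 2"] by simp
  qed (use \<open>\<And>n. \<epsilon> n > 0\<close> in \<open>simp add: less_imp_le\<close>)
  also have "(\<Sum>n. diam_powr rho s (U n)) + ennreal (\<eta> / 2) < ennreal (\<eta> / 2) + ennreal (\<eta> / 2)"
    using U(3) by (subst add.commute) (simp add: ennreal_add_left_cancel_less)
  also have "\<dots> = ennreal \<eta>" using \<open>\<eta> > 0\<close> by (simp flip: ennreal_plus)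
  finally have "infsum f (w ` ?I) < ennreal \<eta>" .
  moreover have "Z \<subseteq> (\<Union>W\<in>w ` ?I. cylinder W)" using U(1) w(2) by fastforce
  moreover have "\<forall>W\<in>w ` ?I. length W > N" using w(1) by auto
  ultimately show "\<exists>C. Z \<subseteq> (\<Union>W\<in>C. cylinder W) \<and> (\<forall>W\<in>C. length W > N) \<and>
     (\<Sum>\<^sub>\<infinity>W\<in>C. ennreal (exp (- (s * ln ?K) * real (length W)))) < ennreal \<eta>"
    unfolding f_def by blast
qed

text \<open>The null exponents correspond under \<open>s \<mapsto> s * ln K\<close>, so their infima
  differ by that positive factor.\<close>

lemma hausdorff_dim_rho_eq:
  fixes Z :: "(nat \<Rightarrow> 'a::finite) set"
  assumes K: "CARD('a) \<ge> 2"
  shows "hausdorff_dim rho Z = ereal (1 / ln (real CARD('a))) * bowen_entropy Z"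
proof -
  let ?c = "ln (real CARD('a))"
  have c: "?c > 0" using K by simp
  have iff: "hausdorff_measure rho s Z = 0 \<longleftrightarrow> bowen_measure (s * ?c) Z = 0" if "0 \<le> s" for s
    using hausdorff_null_if_bowen_null[OF K that] bowen_null_if_hausdorff_null[OF K that] by blast
  have "ereal ` {s. s \<ge> 0 \<and> hausdorff_measure rho s Z = 0} =
      {ereal (1 / ?c) * x |x. x \<in> ereal ` {s. s \<ge> 0 \<and> bowen_measure s Z = 0}}"
    (is "?L = ?R")
  proof (intro subset_antisym subsetI)
    fix z assume "z \<in> ?L"
    then obtain s where s: "z = ereal s" "0 \<le> s" "bowen_measure (s * ?c) Z = 0" using iff by auto
    have "z = ereal (1 / ?c) * ereal (s * ?c)" using c s(1) by simp
    moreover have "0 \<le> s * ?c" using s(2) c by simp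
    ultimately show "z \<in> ?R" using s(3) by blast
  next
    fix z assume "z \<in> ?R"
    then obtain u where u: "z = ereal (1 / ?c) * ereal u" "0 \<le> u" "bowen_measure u Z = 0" by blast
    have "z = ereal (u / ?c)" "0 \<le> u / ?c" "u / ?c * ?c = u" using c u by auto
    then show "z \<in> ?L" using iff[of "u / ?c"] u(3) by auto
  qed
  then show ?thesis
    unfolding hausdorff_dim_def bowen_entropy_def
    using ereal_Inf_cmult[of "1 / ?c" "\<lambda>x. x \<in> ereal ` {s. s \<ge> 0 \<and> bowen_measure s Z = 0}"] c by simp
qed

lemma hausdorff_dim_trivial:
  fixes Z :: "(nat \<Rightarrow> 'a::finite) set"
  assumes "CARD('a) = 1"
  shows "hausdorff_dim rho Z = 0"
proof -
  have eq: "x = y" for x y :: "nat \<Rightarrow> 'a"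
    using assms by (metis card_1_singletonE ext singletonD UNIV_I)
  have diam: "set_diam rho U = 0" for U :: "(nat \<Rightarrow> 'a) set"
  proof -
    have "rho x y = 0" for x y :: "nat \<Rightarrow> 'a" using eq[of x y] by (simp add: rho_def)
    then have "set_diam rho U \<le> 0" unfolding set_diam_def by (intro SUP_least) simp
    then show ?thesis by simp
  qed
  have null: "hausdorff_measure rho s Z = 0" if "s > 0" for s
    unfolding hausdorff_measure_eq_0_iff
  proof (intro allI impI exI[of _ "\<lambda>_. Z"] conjI)
    show "(\<Sum>n::nat. diam_powr rho s Z) < ennreal \<eta>" if "\<eta> > 0" for \<eta>
      using that \<open>s > 0\<close> by (simp add: diam_powr_def diam)
  qed (auto simp: diam)
  have "hausdorff_dim rho Z \<le> ereal s" if "s > 0" for s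
    unfolding hausdorff_dim_def using null[OF that] that by (intro Inf_lower) auto
  then have "hausdorff_dim rho Z \<le> 0" by (metis ereal_le_epsilon2 zero_ereal_def add_0)
  moreover have "0 \<le> hausdorff_dim rho Z"
    unfolding hausdorff_dim_def by (rule Inf_greatest) auto
  ultimately show ?thesis by (rule antisym)
qed

section \<open>Comparison with topological entropy\<close>

lemma bowen_entropy_mono:
  assumes "Z \<subseteq> Z'"
  shows "bowen_entropy Z \<le> bowen_entropy Z'"
  unfolding bowen_entropy_def
proof (rule Inf_superset_mono, rule image_mono, safe)
  fix s assume *: "bowen_measure s Z' = 0"
  show "bowen_measure s Z = 0"
    unfolding bowen_measure_eq_0_iff
  proof (intro allI impI)
    fix N and \<eta> :: real assume "\<eta> > 0"
    then obtain C where "Z' \<subseteq> (\<Union>W\<in>C. cylinder W)" "\<forall>W\<in>C. length W > N"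
      "(\<Sum>\<^sub>\<infinity>W\<in>C. ennreal (exp (- s * real (length W)))) < ennreal \<eta>"
      using *[unfolded bowen_measure_eq_0_iff, THEN spec, of N, THEN spec, of \<eta>] by blast
    then show "\<exists>C. Z \<subseteq> (\<Union>W\<in>C. cylinder W) \<and> (\<forall>W\<in>C. length W > N) \<and>
        (\<Sum>\<^sub>\<infinity>W\<in>C. ennreal (exp (- s * real (length W)))) < ennreal \<eta>"
      using assms by (meson subset_trans)
  qed
qed

text \<open>A null exponent \<open>s\<close> below the topological entropy would leave room for
  growth at some \<open>s3 > s\<close>, and \<open>sum_cover_LY_ge\<close> then bounds all covers
  below by a positive constant.\<close>

lemma topological_entropy_le_bowen_entropy_LY:
  fixes A :: "nat^'a::finite^'a" and \<omega> :: "nat \<Rightarrow> 'a"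
  assumes A: "zero_one_matrix A" "irreducible_matrix A" and \<omega>: "\<omega> \<in> SFT A"
  shows "topological_entropy rho (SFT A) shift \<le> bowen_entropy (LY rho (SFT A) shift \<omega>)"
  unfolding bowen_entropy_def
proof (rule Inf_greatest, safe, rule ccontr)
  fix s :: real assume s: "0 \<le> s" and null: "bowen_measure s (LY rho (SFT A) shift \<omega>) = 0"
  assume "\<not> topological_entropy rho (SFT A) shift \<le> ereal s"
  then have "ereal s < topological_entropy rho (SFT A) shift" by simp
  then obtain u where u: "ereal s < ereal u" "ereal u < topological_entropy rho (SFT A) shift"
    using ereal_dense2 by blast
  define s3 where "s3 = (s + u) / 2"
  have "s < s3" "s3 < u" using u(1) by (auto simp: s3_def)
  then have "growth_above A s3"
    using growth_above_if_less_topological_entropy[OF A(1) u(2), of s3] s by simp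
  then obtain c where c: "c > 0" "\<And>C. LY rho (SFT A) shift \<omega> \<subseteq> (\<Union>W\<in>C. cylinder W) \<Longrightarrow>
      ennreal c \<le> (\<Sum>\<^sub>\<infinity>W\<in>C. ennreal (exp (- s * real (length W))))"
    using sum_cover_LY_ge[OF A \<omega> s \<open>s < s3\<close>] by blast
  obtain C where "LY rho (SFT A) shift \<omega> \<subseteq> (\<Union>W\<in>C. cylinder W)"
    "(\<Sum>\<^sub>\<infinity>W\<in>C. ennreal (exp (- s * real (length W)))) < ennreal c"
    using null[unfolded bowen_measure_eq_0_iff, THEN spec, of 0, THEN spec, of c] c(1) by blast
  with c(2) show False by (meson not_le)
qed

text \<open>Points with different blocks of length \<open>n\<close> are at distance 1 at some time
  below \<open>n\<close>, so the number of these blocks is bounded through separated sets at scale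
  1/2. Covering by the corresponding cylinders has small weight at every exponent above the growth
  rate.\<close>

lemma bowen_entropy_SFT_le_topological_entropy:
  fixes A :: "nat^'a::finite^'a"
  assumes A: "zero_one_matrix A"
  shows "bowen_entropy (SFT A) \<le> topological_entropy rho (SFT A) shift"
proof (rule ccontr)
  let ?h = "topological_entropy rho (SFT A) shift"
  let ?f = "\<lambda>n. SUP E\<in>{E. E \<subseteq> SFT A \<and> finite E \<and> separated rho shift n (1 / 2) E}.
        ereal (ln (real (card E)) / real n)"
  assume "\<not> ?thesis"
  then have "?h < bowen_entropy (SFT A)" by simp
  then obtain u where u: "?h < ereal u" "ereal u < bowen_entropy (SFT A)"
    using ereal_dense2 by blast
  obtain v where v: "?h < ereal v" "ereal v < ereal u"
    using ereal_dense2[OF u(1)] by blast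
  have le: "limsup ?f \<le> ?h"
    unfolding topological_entropy_def by (rule SUP_upper) simp
  \<comment> \<open>The empty set contributes \<open>ln 0 / n = 0\<close>. Hence
    \<open>v > 0\<close>, so that \<open>u\<close> is an admissible exponent.\<close>
  have nonneg: "0 \<le> ?f n" for n
    by (rule SUP_upper2[of "{}"]) (auto simp: separated_def)
  have "0 \<le> limsup ?f"
    by (rule le_Limsup) (use nonneg in auto)
  then have "0 < ereal v" using le v(1) by (meson le_less_trans order_trans)
  then have "0 < v" by simp
  have "limsup ?f < ereal v" using le v(1) by (rule le_less_trans)
  then obtain n0 where n0: "\<And>n. n \<ge> n0 \<Longrightarrow> ?f n < ereal v"
    using Limsup_lessD[of sequentially ?f "ereal v"] unfolding eventually_sequentially by blast
  have card_le: "real (card ((\<lambda>x. block x 0 n) ` SFT A)) \<le> exp (v * real n)" if "n \<ge> n0" "n > 0" for n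
  proof -
    let ?g = "\<lambda>x. block x 0 n :: 'a list"
    \<comment> \<open>One representative in \<open>SFT A\<close> for each occurring block.\<close>
    obtain E where E: "E \<subseteq> SFT A" "inj_on ?g E" "?g ` SFT A = ?g ` E"
      using subset_image_inj[of "?g ` SFT A" ?g "SFT A"] by auto
    have "finite E" using card_blocks_le(1)[OF A E(1)] E(2) by (rule finite_imageD)
    moreover have "separated rho shift n (1 / 2) E"
      unfolding separated_def
    proof (intro ballI impI)
      fix x y assume "x \<in> E" "y \<in> E" "x \<noteq> y"
      then have "?g x \<noteq> ?g y" using E(2) by (auto simp: inj_on_def)
      then obtain k where "k < n" "x k \<noteq> y k" by (auto simp: block_def)
      then show "\<exists>k<n. 1 / 2 < rho ((shift ^^ k) x) ((shift ^^ k) y)"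
        by (intro exI[of _ k]) (simp add: rho_eq_1 shift_funpow)
    qed
    ultimately have "ereal (ln (real (card E)) / real n) \<le> ?f n"
      using E(1) by (intro SUP_upper) auto
    then have "ereal (ln (real (card E)) / real n) < ereal v"
      using n0[OF that(1)] by (rule le_less_trans)
    then have ln: "ln (real (card E)) < v * real n" using that(2) by (simp add: field_simps)
    have "real (card E) \<le> exp (v * real n)"
    proof (cases "card E = 0")
      case False
      then have "real (card E) = exp (ln (real (card E)))" by simp
      also have "\<dots> \<le> exp (v * real n)" using ln by simp
      finally show ?thesis .
    qed simp
    moreover have "card (?g ` SFT A) = card E" unfolding E(3) by (rule card_image[OF E(2)])
    ultimately show ?thesis by simp
  qed
  have "bowen_measure u (SFT A) = 0"
    unfolding bowen_measure_eq_0_iff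
  proof (intro allI impI)
    fix N and \<eta> :: real assume "\<eta> > 0"
    have "u > v" using v(2) by simp
    \<comment> \<open>Beyond this threshold \<open>exp ((v - u) * n) < \<eta>\<close>.\<close>
    obtain n1 where n1: "- ln \<eta> / (u - v) < real n1" using reals_Archimedean2 by blast
    define n where "n = max n1 (max n0 (Suc N))"
    have n: "n > N" "n \<ge> n0" "n > 0" by (auto simp: n_def)
    have "- ln \<eta> / (u - v) < real n" using n1 by (simp add: n_def)
    then have "v * real n + - u * real n < ln \<eta>" using \<open>u > v\<close> by (simp add: field_simps)
    then have "exp (v * real n + - u * real n) < exp (ln \<eta>)" by (simp only: exp_less_cancel_iff)
    then have small: "exp (v * real n) * exp (- u * real n) < \<eta>"
      using \<open>\<eta> > 0\<close> by (simp only: exp_add exp_ln)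
    let ?C = "(\<lambda>x. block x 0 n) ` SFT A"
    have len: "length W = n" if "W \<in> ?C" for W using that by (auto simp: block_def)
    have "(\<Sum>\<^sub>\<infinity>W\<in>?C. ennreal (exp (- u * real (length W)))) = (\<Sum>W\<in>?C. ennreal (exp (- u * real n)))"
      using card_blocks_le(1)[OF A order_refl, of n] len by (simp cong: sum.cong)
    also have "\<dots> = ennreal (real (card ?C) * exp (- u * real n))"
      by (simp add: ennreal_mult ennreal_of_nat_eq_real_of_nat)
    also have "\<dots> \<le> ennreal (exp (v * real n) * exp (- u * real n))"
      using card_le[OF n(2,3)] by (intro ennreal_leI mult_right_mono) auto
    also have "\<dots> < ennreal \<eta>" using small \<open>\<eta> > 0\<close> by (simp add: ennreal_lessI)
    finally have "(\<Sum>\<^sub>\<infinity>W\<in>?C. ennreal (exp (- u * real (length W)))) < ennreal \<eta>" .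
    moreover have "SFT A \<subseteq> (\<Union>W\<in>?C. cylinder W)"
      by (auto simp: cylinder_def block_def)
    ultimately show "\<exists>C. SFT A \<subseteq> (\<Union>W\<in>C. cylinder W) \<and> (\<forall>W\<in>C. length W > N) \<and>
        (\<Sum>\<^sub>\<infinity>W\<in>C. ennreal (exp (- u * real (length W)))) < ennreal \<eta>"
      using len n(1) by (intro exI[of _ ?C] conjI ballI) simp_all
  qed
  then have "bowen_entropy (SFT A) \<le> ereal u"
    unfolding bowen_entropy_def using \<open>0 < v\<close> v(2) by (intro Inf_lower) auto
  then show False using u(2) by simp
qed

theorem theorem1p1:
  fixes A :: "nat^'a^'a" and \<omega> :: "nat \<Rightarrow> 'a::finite"
  assumes "zero_one_matrix A"
    and "irreducible_matrix A"
    and "\<omega> \<in> SFT A"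
  shows "bowen_entropy (LY rho (SFT A) shift \<omega>) = topological_entropy rho (SFT A) shift
       \<and> hausdorff_dim rho (LY rho (SFT A) shift \<omega>) = hausdorff_dim rho (SFT A)"
proof -
  have "LY rho (SFT A) shift \<omega> \<subseteq> SFT A" by (auto simp: LY_def)
  then have "bowen_entropy (LY rho (SFT A) shift \<omega>) \<le> bowen_entropy (SFT A)"
    by (rule bowen_entropy_mono)
  \<comment> \<open>The three inequalities close a cycle between the entropy of the partners, that
    of the subshift, and the topological entropy.\<close>
  then have eq: "bowen_entropy (LY rho (SFT A) shift \<omega>) = topological_entropy rho (SFT A) shift"
    "bowen_entropy (LY rho (SFT A) shift \<omega>) = bowen_entropy (SFT A)"
    using topological_entropy_le_bowen_entropy_LY[OF assms]
      bowen_entropy_SFT_le_topological_entropy[OF assms(1)] by auto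
  have "hausdorff_dim rho (LY rho (SFT A) shift \<omega>) = hausdorff_dim rho (SFT A)"
  proof (cases "CARD('a) = 1")
    case False
    moreover have "CARD('a) > 0" by simp
    ultimately have "CARD('a) \<ge> 2" by linarith
    then show ?thesis by (simp add: hausdorff_dim_rho_eq eq(2))
  qed (simp add: hausdorff_dim_trivial)
  with eq(1) show ?thesis by blast
qed

end
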